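(* For any integer $n\geq 2$, the following statements are equivalent: (i) the vertex connectivity and the algebraic connectivity of $\mathcal{G}(Q_n)$ are equal; (ii) the algebraic connectivity of $\mathcal{G}(Q_n)$ is $2$; (iii) the algebraic connectivity of $\mathcal{G}(Q_n)$ is an integer; (iv) $\mathcal{G}(Q_n)$ is Laplacian integral; (v) $Q_n$ is generalized quaternion.
   Context: For $n\ge 2$, the dicyclic group $Q_n$ is the group of order $4n$ with presentation $\langle a,b \mid a^{2n}=e,\ a^n=b^2,\ ab=ba^{-1}\rangle$; it is generalized quaternion when $n$ is a power of $2$. The power graph $\mathcal{G}(G)$ of a group $G$ has vertex set $G$, distinct $u,v$ adjacent iff one is a positive power of the other. The vertex connectivity of a graph is the minimum number of vertices whose removal leaves a disconnected or one-vertex graph. For a graph on $m$ vertices, the algebraic connectivity is $\lambda_{m-1}$, the second smallest eigenvalue of the Laplacian $L=D-A$ (degree matrix minus adjacency matrix). A graph is Laplacian integral if all its Laplacian eigenvalues are integers. *)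

theory Defs
  imports
    "HOL-Algebra.Generated_Groups"
    "Graph_Theory.Graph_Theory"
    "Jordan_Normal_Form.Spectral_Radius"
begin

section \<open>Dicyclic and generalized quaternion groups\<close>

text \<open>
  A group generated by two elements satisfying the three relations is a quotient of the group
  with the presentation. The latter has order \<open>4n\<close>, so requiring order \<open>4n\<close> describes it up to
  isomorphism.
\<close>

definition dicyclic :: "nat \<Rightarrow> ('a, 'b) monoid_scheme \<Rightarrow> bool" where
  "dicyclic n G \<longleftrightarrow>
     n \<ge> 2 \<and> group G \<and> Coset.order G = 4 * n \<and>
     (\<exists>a \<in> carrier G. \<exists>b \<in> carrier G.
        generate G {a, b} = carrier G \<and>
        a [^]\<^bsub>G\<^esub> (2 * n) = \<one>\<^bsub>G\<^esub> \<and>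
        a [^]\<^bsub>G\<^esub> n = b [^]\<^bsub>G\<^esub> (2 :: nat) \<and>
        a \<otimes>\<^bsub>G\<^esub> b = b \<otimes>\<^bsub>G\<^esub> inv\<^bsub>G\<^esub> a)"

definition generalized_quaternion :: "('a, 'b) monoid_scheme \<Rightarrow> bool" where
  "generalized_quaternion G \<longleftrightarrow> (\<exists>k. dicyclic (2 ^ k) G)"

text \<open>
  Existence: the pair \<open>(i, e)\<close> stands for \<open>a\<^sup>i\<close> if \<open>e\<close> is false and for \<open>a\<^sup>i b\<close> if \<open>e\<close> is true.
\<close>

definition dicyclic_group :: "nat \<Rightarrow> (int \<times> bool) monoid" where
  "dicyclic_group n =
     \<lparr> carrier = {0..<2 * int n} \<times> UNIV,
       monoid.mult = (\<lambda>(i, e) (j, f).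
         ((i + (if e then - j else j) + (if e \<and> f then int n else 0)) mod (2 * int n), e \<noteq> f)),
       monoid.one = (0, False) \<rparr>"

lemma group_dicyclic_group:
  assumes "n > 0"
  shows "group (dicyclic_group n)"
proof (rule groupI)
  fix x y z
  assume "x \<in> carrier (dicyclic_group n)" "y \<in> carrier (dicyclic_group n)"
    "z \<in> carrier (dicyclic_group n)"
  obtain i e j f k g where xyz: "x = (i, e)" "y = (j, f)" "z = (k, g)"
    by (metis surj_pair)
  have two: "(u + int n * 2) mod (2 * int n) = u mod (2 * int n)" for u
    by (metis mult.commute mod_add_self2)
  show "x \<otimes>\<^bsub>dicyclic_group n\<^esub> y \<otimes>\<^bsub>dicyclic_group n\<^esub> z =
        x \<otimes>\<^bsub>dicyclic_group n\<^esub> (y \<otimes>\<^bsub>dicyclic_group n\<^esub> z)"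
  proof -
    have "(if e \<noteq> f then (i + (if e then - j else j) + (if e \<and> f then int n else 0)) - k + (if g then int n else 0)
           else (i + (if e then - j else j) + (if e \<and> f then int n else 0)) + k) mod (2 * int n)
        = (i + (if e then - (j + (if f then - k else k) + (if f \<and> g then int n else 0))
                else (j + (if f then - k else k) + (if f \<and> g then int n else 0)))
            + (if e \<and> (f \<noteq> g) then int n else 0)) mod (2 * int n)"
      using two[of "i - j + k - int n"] two[of "i - j - k - int n"]
      by (cases e; cases f; cases g) (simp_all add: algebra_simps)
    moreover have "(int n + u mod (int n * 2) - k) mod (int n * 2) = (int n + u - k) mod (int n * 2)" for u
      by (metis mod_add_right_eq mod_diff_left_eq)
    ultimately show ?thesis
      unfolding xyz dicyclic_group_def
      by (cases e; cases f; cases g) (simp_all add: mod_simps algebra_simps)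
  qed
next
  fix x
  assume x: "x \<in> carrier (dicyclic_group n)"
  obtain i e where xe: "x = (i, e)" by (metis surj_pair)
  have "((i + int n) mod (2 * int n) - i + int n) mod (2 * int n) = 0"
  proof -
    have "((i + int n) mod (2 * int n) - i + int n) mod (2 * int n)
        = ((i + int n) mod (2 * int n) - (i - int n)) mod (2 * int n)"
      by (simp add: algebra_simps)
    also have "\<dots> = (i + int n - (i - int n)) mod (2 * int n)"
      by (rule mod_diff_left_eq)
    finally show ?thesis by simp
  qed
  then show "\<exists>y\<in>carrier (dicyclic_group n). y \<otimes>\<^bsub>dicyclic_group n\<^esub> x = \<one>\<^bsub>dicyclic_group n\<^esub>"
    using assms x unfolding xe
    by (intro bexI[of _ "((if e then i + int n else - i) mod (2 * int n), e)"])
       (auto simp: dicyclic_group_def mod_simps)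
qed (use assms in \<open>auto simp: dicyclic_group_def\<close>)

lemma dicyclic_dicyclic_group:
  assumes "n \<ge> 2"
  shows "dicyclic n (dicyclic_group n)"
proof -
  let ?G = "dicyclic_group n" and ?a = "(1, False) :: int \<times> bool" and ?b = "(0, True) :: int \<times> bool"
  interpret group ?G using assms by (intro group_dicyclic_group) simp
  have in_carrier: "?a \<in> carrier ?G" "?b \<in> carrier ?G"
    using assms by (auto simp: dicyclic_group_def)
  have pow: "?a [^]\<^bsub>?G\<^esub> k = (int k mod (2 * int n), False)" for k :: nat
    using assms by (induction k) (auto simp: dicyclic_group_def mod_simps add.commute)
  have "carrier ?G \<subseteq> generate ?G {?a, ?b}"
  proof
    fix x
    assume x: "x \<in> carrier ?G"
    then obtain i e where xe: "x = (i, e)" "0 \<le> i" "i < 2 * int n"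
      by (auto simp: dicyclic_group_def)
    have "?a [^]\<^bsub>?G\<^esub> k \<in> generate ?G {?a, ?b}" for k :: nat
      by (induction k) (auto intro: generate.intros)
    from this[of "nat i"] have i: "(i, False) \<in> generate ?G {?a, ?b}"
      using xe by (simp add: pow)
    have "(i, True) = (i, False) \<otimes>\<^bsub>?G\<^esub> ?b"
      using xe by (simp add: dicyclic_group_def)
    with i have "(i, True) \<in> generate ?G {?a, ?b}"
      by (auto intro: generate.intros)
    with i show "x \<in> generate ?G {?a, ?b}"
      using xe by (cases e) auto
  qed
  then have gen: "generate ?G {?a, ?b} = carrier ?G"
    using generate_incl[of "{?a, ?b}"] in_carrier by auto
  have "inv\<^bsub>?G\<^esub> ?a = (2 * int n - 1, False)"
    using assms in_carrier by (intro inv_equality) (auto simp: dicyclic_group_def)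
  then have rel: "?a \<otimes>\<^bsub>?G\<^esub> ?b = ?b \<otimes>\<^bsub>?G\<^esub> inv\<^bsub>?G\<^esub> ?a"
    using assms mod_add_self2[of 1 "2 * int n"] by (simp add: dicyclic_group_def zmod_zminus1_eq_if)
  have sq: "?a [^]\<^bsub>?G\<^esub> n = ?b [^]\<^bsub>?G\<^esub> (2 :: nat)"
    using assms unfolding pow by (simp add: dicyclic_group_def numeral_2_eq_2)
  have "?a [^]\<^bsub>?G\<^esub> (2 * n) = \<one>\<^bsub>?G\<^esub>"
    unfolding pow by (simp add: dicyclic_group_def)
  moreover have "Coset.order ?G = 4 * n"
    by (simp add: Coset.order_def dicyclic_group_def card_cartesian_product nat_mult_distrib)
  ultimately show ?thesis
    unfolding dicyclic_def using assms in_carrier gen rel sq is_group by blast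
qed

section \<open>Power graphs\<close>

text \<open>
  Following \<^theory>\<open>Graph_Theory.Digraph\<close>, undirected graphs are symmetric digraphs.
\<close>

definition power_graph :: "('a, 'b) monoid_scheme \<Rightarrow> 'a pair_pre_digraph" where
  "power_graph G =
     \<lparr> pverts = carrier G,
       parcs = {(u, v) \<in> carrier G \<times> carrier G. u \<noteq> v \<and>
         (\<exists>k > (0 :: nat). v = u [^]\<^bsub>G\<^esub> k \<or> u = v [^]\<^bsub>G\<^esub> k)} \<rparr>"

lemma (in group) pair_graph_power_graph:
  assumes "finite (carrier G)"
  shows "pair_graph (power_graph G)"
proof -
  have "parcs (power_graph G) \<subseteq> carrier G \<times> carrier G"
    by (auto simp: power_graph_def)
  then have "finite (parcs (power_graph G))"
    using assms by (meson finite_SigmaI finite_subset)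
  then show ?thesis
    using assms
    by unfold_locales (auto simp: power_graph_def symmetric_def intro!: symI)
qed

section \<open>Vertex connectivity\<close>

text \<open>
  The inclusion is strict because \<^const>\<open>Digraph_Component.connected\<close> is false for the graph
  without vertices.
\<close>

definition vertex_connectivity :: "'a pair_pre_digraph \<Rightarrow> nat" where
  "vertex_connectivity \<Gamma> =
     (LEAST k. \<exists>S. S \<subset> pverts \<Gamma> \<and> card S = k \<and>
        (\<not> Digraph_Component.connected (with_proj \<Gamma> \<restriction> (pverts \<Gamma> - S)) \<or>
         card (pverts \<Gamma> - S) = 1))"

section \<open>Laplacian eigenvalues\<close>

text \<open>
  The rows and columns of the matrices are indexed along an arbitrary enumeration of the vertices;
  another enumeration conjugates them by a permutation matrix and leaves the characteristic
  polynomial unchanged.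
\<close>

definition vertex_list :: "'a pair_pre_digraph \<Rightarrow> 'a list" where
  "vertex_list \<Gamma> = (SOME vs. distinct vs \<and> set vs = pverts \<Gamma>)"

definition adjacency_matrix :: "'a pair_pre_digraph \<Rightarrow> real mat" where
  "adjacency_matrix \<Gamma> =
     mat (card (pverts \<Gamma>)) (card (pverts \<Gamma>))
       (\<lambda>(i, j). if (vertex_list \<Gamma> ! i, vertex_list \<Gamma> ! j) \<in> parcs \<Gamma> then 1 else 0)"

definition degree_matrix :: "'a pair_pre_digraph \<Rightarrow> real mat" where
  "degree_matrix \<Gamma> =
     mat_diag (card (pverts \<Gamma>)) (\<lambda>i. real (out_degree (with_proj \<Gamma>) (vertex_list \<Gamma> ! i)))"

definition laplacian :: "'a pair_pre_digraph \<Rightarrow> real mat" where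
  "laplacian \<Gamma> = degree_matrix \<Gamma> - adjacency_matrix \<Gamma>"

text \<open>
  The eigenvalues with multiplicity, in increasing order. Since the Laplacian is a real symmetric
  matrix, all complex roots of its characteristic polynomial are real.
\<close>

definition laplacian_eigenvalues :: "'a pair_pre_digraph \<Rightarrow> real list" where
  "laplacian_eigenvalues \<Gamma> = sorted_list_of_multiset (proots (char_poly (laplacian \<Gamma>)))"

text \<open>Meaningful for graphs with at least two vertices.\<close>

definition algebraic_connectivity :: "'a pair_pre_digraph \<Rightarrow> real" where
  "algebraic_connectivity \<Gamma> = laplacian_eigenvalues \<Gamma> ! 1"

definition laplacian_integral :: "'a pair_pre_digraph \<Rightarrow> bool" where
  "laplacian_integral \<Gamma> \<longleftrightarrow> (\<forall>\<mu>. eigenvalue (laplacian \<Gamma>) \<mu> \<longrightarrow> \<mu> \<in> \<int>)"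

end

theory Submission
  imports Defs "HOL-Number_Theory.Cong" "HOL-Algebra.Multiplicative_Group"
begin

text \<open>
  Write \<open>A = \<langle>a\<rangle>\<close>, \<open>B = A b\<close> and \<open>z = a\<^sup>n\<close>. In the power graph the identity is adjacent to everything,
  a generator of \<open>A\<close> to all of \<open>A\<close>, and each \<open>u \<in> B\<close> exactly to \<open>1\<close>, \<open>z\<close> and \<open>u\<inverse> = z u\<close>. Hence removing
  \<open>1\<close> and \<open>z\<close> disconnects the graph while no single vertex does, so the vertex connectivity is
  always \<open>2\<close>.

  By the spectral theorem the algebraic connectivity \<open>\<lambda>\<close> is the minimum of the Rayleigh quotient
  on functions of sum zero. The edges at the identity alone contribute
  \<open>\<parallel>f\<parallel>\<^sup>2 + 4 n f(1)\<^sup>2\<close> to the Dirichlet form, and the graph without the identity is connected, so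
  \<open>\<lambda> > 1\<close>. The function vanishing at \<open>1\<close> and \<open>z\<close>, equal to \<open>- (n - 1)\<close> on \<open>B\<close> and to \<open>n\<close> on the rest
  of \<open>A\<close>, shows \<open>\<lambda> \<le> 2\<close>, and \<open>\<lambda> < 2\<close> if \<open>z\<close> is not adjacent to all of \<open>A\<close>. The latter happens
  as soon as \<open>n\<close> has an odd divisor \<open>m > 1\<close>: take an element of order \<open>m\<close>. If \<open>n\<close> is a power of
  two, then \<open>A\<close> is a clique, so \<open>1\<close> and \<open>z\<close> are both adjacent to everything, which gives \<open>\<lambda> = 2\<close> and
  eigenvalues in \<open>{0, 2, 4, 2 n, 4 n}\<close>.
\<close>

section \<open>Spectral theorem for real symmetric matrices\<close>

text \<open>Complete \<open>v\<close> to a basis, apply Gram-Schmidt and normalize. Gram-Schmidt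
  keeps the first vector, so the first column is \<open>v\<close> up to the normalizing factor
  \<open>c\<close>.\<close>

lemma orthogonal_matrix_first_column:
  fixes v :: "real vec"
  assumes v: "v \<in> carrier_vec n" and v0: "v \<noteq> 0\<^sub>v n"
  obtains W c where "W \<in> carrier_mat n n" "transpose_mat W * W = 1\<^sub>m n" "col W 0 = c \<cdot>\<^sub>v v"
proof -
  interpret cof_vec_space n "TYPE(real)" .
  define ws where "ws = gram_schmidt n (basis_completion v)"
  note bc = basis_completion[OF v v0]
  have n: "n > 0"
  proof (rule ccontr)
    assume "\<not> n > 0"
    then have "v = 0\<^sub>v n" using v by (intro eq_vecI) auto
    with v0 show False by simp
  qed
  have ws: "set ws \<subseteq> carrier_vec n" "corthogonal ws" "length ws = n"
    using gram_schmidt_result[OF bc(2) bc(4) bc(5) ws_def] bc(6) by auto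
  obtain vs where "basis_completion v = v # vs"
    using bc(6,7) n by (cases "basis_completion v") auto
  then have hd: "ws ! 0 = v"
    using gram_schmidt_hd[OF v, of vs] ws(3) n by (metis hd_conv_nth length_greater_0_conv ws_def)
  have wsi: "ws ! i \<in> carrier_vec n" if "i < n" for i
    using ws(1,3) that by auto
  define c where "c i = 1 / sqrt (ws ! i \<bullet> ws ! i)" for i
  define W where "W = mat_of_cols n (map (\<lambda>i. c i \<cdot>\<^sub>v ws ! i) [0..<n])"
  have W: "W \<in> carrier_mat n n" by (simp add: W_def mat_of_cols_def)
  have colW: "col W i = c i \<cdot>\<^sub>v ws ! i" if "i < n" for i
    using that wsi[OF that] by (simp add: W_def)
  have orth: "(ws ! i \<bullet> ws ! j = 0) = (i \<noteq> j)" if "i < n" "j < n" for i j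
    using corthogonalD[OF ws(2), of i j] that ws(3) by simp
  have "transpose_mat W * W = 1\<^sub>m n"
  proof (rule eq_matI)
    fix i j assume "i < dim_row (1\<^sub>m n :: real mat)" "j < dim_col (1\<^sub>m n :: real mat)"
    then have ij: "i < n" "j < n" by auto
    have "(transpose_mat W * W) $$ (i, j) = c i * c j * (ws ! i \<bullet> ws ! j)"
      using ij W smult_scalar_prod_distrib[of "ws ! i" n "c j \<cdot>\<^sub>v ws ! j" "c i"]
        scalar_prod_smult_distrib[OF wsi[OF ij(1)] wsi[OF ij(2)], of "c j"] wsi[OF ij(1)] wsi[OF ij(2)]
      by (simp add: colW)
    also have "\<dots> = (if i = j then 1 else 0)"
    proof (cases "i = j")
      case True
      have "ws ! i \<bullet> ws ! i > 0"
        using orth[OF ij(1) ij(1)] by (auto simp: less_le scalar_prod_def intro!: sum_nonneg)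
      then show ?thesis using True by (simp add: c_def)
    qed (use orth[OF ij] in simp)
    finally show "(transpose_mat W * W) $$ (i, j) = 1\<^sub>m n $$ (i, j)" using ij by simp
  qed (use W in auto)
  moreover have "col W 0 = c 0 \<cdot>\<^sub>v v" using colW[OF n] hd by simp
  ultimately show ?thesis using W that by blast
qed

text \<open>As in \<^theory>\<open>Jordan_Normal_Form.Schur_Decomposition\<close>, the list \<open>es\<close> prescribes the order.\<close>

theorem real_symmetric_diagonalization:
  fixes A :: "real mat"
  assumes "A \<in> carrier_mat n n" and "transpose_mat A = A"
    and "char_poly A = (\<Prod>e\<leftarrow>es. [:- e, 1:])"
  shows "\<exists>P \<in> carrier_mat n n. transpose_mat P * P = 1\<^sub>m n \<and>
    transpose_mat P * A * P = mat_diag n (\<lambda>i. es ! i)"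
  using assms
proof (induction es arbitrary: n A)
  case Nil
  with degree_monic_char_poly[of A n] have "n = 0" by auto
  with Nil show ?case by (intro bexI[of _ "1\<^sub>m 0"]) (auto simp: mat_diag_def intro!: eq_matI)
next
  case (Cons e es n A)
  note A = Cons.prems(1) and sym = Cons.prems(2) and cp = Cons.prems(3)
  have mon: "monic (\<Prod>e\<leftarrow>es. [:- e, 1:])" by (rule monic_prod_list) auto
  have "degree (char_poly A) = Suc (degree (\<Prod>e\<leftarrow>es. [:- e, 1:]))"
    unfolding cp list.map prod_list.Cons by (subst degree_mult_eq) (use mon in auto)
  then obtain m where n: "n = Suc m" using degree_monic_char_poly[OF A] by (cases n) auto
  have "eigenvalue A e" unfolding eigenvalue_root_char_poly[OF A] cp by simp
  then obtain v where v: "v \<in> carrier_vec n" "v \<noteq> 0\<^sub>v n" "A *\<^sub>v v = e \<cdot>\<^sub>v v"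
    using A unfolding eigenvalue_def eigenvector_def by auto
  obtain W c where W: "W \<in> carrier_mat n n" and WW: "transpose_mat W * W = 1\<^sub>m n"
    and W0: "col W 0 = c \<cdot>\<^sub>v v"
    using orthogonal_matrix_first_column[OF v(1,2)] by blast
  define W' where "W' = transpose_mat W"
  have W': "W' \<in> carrier_mat n n" using W by (simp add: W'_def)
  have W'W: "W' * W = 1\<^sub>m n" using WW by (simp add: W'_def)
  have WW': "W * W' = 1\<^sub>m n" by (rule mat_mult_left_right_inverse[OF W' W W'W])
  define A' where "A' = W' * A * W"
  have A': "A' \<in> carrier_mat n n" using A W W' by (simp add: A'_def)
  have symA': "transpose_mat A' = A'"
    unfolding A'_def using A W W' sym
    by (simp add: transpose_mult[of _ n n _ n] W'_def assoc_mult_mat[of _ n n _ n _ n])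
  have colW: "col W 0 \<in> carrier_vec n" using W by (metis carrier_matD(1) col_dim)
  have "col A' 0 = W' *\<^sub>v (A *\<^sub>v col W 0)"
    unfolding A'_def using A W W' n
      col_mult2[of W' n n "A * W" n 0] col_mult2[of A n n W n 0] by simp
  also have "A *\<^sub>v col W 0 = e \<cdot>\<^sub>v col W 0"
    unfolding W0 using A v by (simp add: mult_mat_vec[of _ n n] smult_smult_assoc mult.commute)
  also have "W' *\<^sub>v (e \<cdot>\<^sub>v col W 0) = e \<cdot>\<^sub>v col (W' * W) 0"
    using W W' n col_mult2[of W' n n W n 0] mult_mat_vec[OF W' colW, of e] by simp
  finally have col0: "A' $$ (i, 0) = (if i = 0 then e else 0)" if "i < n" for i
    using that A' n unfolding W'W by (auto simp: vec_eq_iff)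
  \<comment> \<open>Symmetry carries the zeros of the first column over to the first row. The matrix
    therefore splits into diagonal blocks, where a general Schur step would only give a triangular
    shape.\<close>
  have row0: "A' $$ (0, i) = (if i = 0 then e else 0)" if "i < n" for i
    using col0[OF that] symA' A' that n by (metis carrier_matD index_transpose_mat(1) zero_less_Suc)
  define E where "E = mat 1 1 (\<lambda>_. e)"
  define A3 where "A3 = mat m m (\<lambda>(i, j). A' $$ (Suc i, Suc j))"
  have E: "E \<in> carrier_mat 1 1" and A3: "A3 \<in> carrier_mat m m" by (auto simp: E_def A3_def)
  have blk: "A' = four_block_mat E (0\<^sub>m 1 m) (0\<^sub>m m 1) A3"
    using A' col0 row0 by (intro eq_matI) (auto simp: n E_def A3_def)
  have symA3: "transpose_mat A3 = A3"
  proof (rule eq_matI)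
    fix i j assume "i < dim_row A3" "j < dim_col A3"
    then have ij: "i < m" "j < m" by (auto simp: A3_def)
    have "A' $$ (Suc j, Suc i) = transpose_mat A' $$ (Suc i, Suc j)"
      using ij A' n by simp
    then show "transpose_mat A3 $$ (i, j) = A3 $$ (i, j)"
      using ij by (simp add: A3_def symA')
  qed (auto simp: A3_def)
  have "similar_mat_wit A' A W' W"
    by (rule similar_mat_witI[of _ _ n]) (use A A' W W' W'W WW' in \<open>auto simp: A'_def\<close>)
  then have "char_poly A' = char_poly A"
    by (intro char_poly_similar) (auto simp: similar_mat_def)
  moreover have "char_poly A' = char_poly E * char_poly A3"
    unfolding blk by (rule char_poly_four_block_zeros_col[OF E _ A3]) simp
  moreover have "char_poly E = [:- e, 1:]"
    by (simp add: E_def char_poly_defs det_def sign_def)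
  \<comment> \<open>Cancelling the factor of \<open>e\<close> leaves the remaining list for the
    smaller symmetric block, in the prescribed order, so the induction hypothesis applies.\<close>
  ultimately have "[:- e, 1:] * char_poly A3 = [:- e, 1:] * (\<Prod>e\<leftarrow>es. [:- e, 1:])"
    unfolding cp by simp
  then have "char_poly A3 = (\<Prod>e\<leftarrow>es. [:- e, 1:])"
    by (subst (asm) mult_cancel_left) simp
  from Cons.IH[OF A3 symA3 this] obtain P3 where P3: "P3 \<in> carrier_mat m m"
    "transpose_mat P3 * P3 = 1\<^sub>m m" "transpose_mat P3 * A3 * P3 = mat_diag m (\<lambda>i. es ! i)"
    by auto
  \<comment> \<open>\<open>R\<close> fixes the eigenvector split off and diagonalizes its orthogonal
    complement.\<close>
  define R where "R = four_block_mat (1\<^sub>m 1) (0\<^sub>m 1 m) (0\<^sub>m m 1) P3"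
  have R: "R \<in> carrier_mat n n" using four_block_carrier_mat[OF one_carrier_mat[of 1] P3(1)] n by (simp add: R_def)
  have R': "transpose_mat R = four_block_mat (1\<^sub>m 1) (0\<^sub>m 1 m) (0\<^sub>m m 1) (transpose_mat P3)"
    unfolding R_def using P3 by (subst transpose_four_block_mat[of _ 1 1 _ m _ m]) (auto simp: transpose_one)
  have RR: "transpose_mat R * R = 1\<^sub>m n"
    unfolding R' unfolding R_def
    by (subst mult_four_block_mat[of _ 1 1 _ m _ m _ _ 1 _ m])
       (use P3 in \<open>auto simp: n\<close>)
  have RAR: "transpose_mat R * A' * R = mat_diag n (\<lambda>i. (e # es) ! i)"
  proof -
    have "transpose_mat R * A' = four_block_mat E (0\<^sub>m 1 m) (0\<^sub>m m 1) (transpose_mat P3 * A3)"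
      unfolding R' blk
      by (subst mult_four_block_mat[of _ 1 1 _ m _ m _ _ 1 _ m])
         (use P3 A3 E in auto)
    then have "transpose_mat R * A' * R =
        four_block_mat E (0\<^sub>m 1 m) (0\<^sub>m m 1) (transpose_mat P3 * A3 * P3)"
      unfolding R_def
      by (simp, subst mult_four_block_mat[of _ 1 1 _ m _ m _ _ 1 _ m])
         (use P3 A3 E in auto)
    also have "\<dots> = mat_diag n (\<lambda>i. (e # es) ! i)"
      unfolding P3(3) by (intro eq_matI) (auto simp: n E_def mat_diag_def nth_Cons')
    finally show ?thesis .
  qed
  define P where "P = W * R"
  have P: "P \<in> carrier_mat n n" using W R by (simp add: P_def)
  have P': "transpose_mat P = transpose_mat R * W'"
    unfolding P_def W'_def by (rule transpose_mult[OF W R])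
  have R'c: "transpose_mat R \<in> carrier_mat n n" using R by simp
  have "transpose_mat P * P = transpose_mat R * (W' * W) * R"
    unfolding P' unfolding P_def using R R'c W W' by (simp add: assoc_mult_mat[of _ n n _ n _ n])
  then have "transpose_mat P * P = 1\<^sub>m n"
    using R R'c by (simp add: W'W RR)
  moreover have "transpose_mat P * A * P = transpose_mat R * A' * R"
    unfolding P' unfolding P_def A'_def using A R R'c W W'
    by (simp add: assoc_mult_mat[of _ n n _ n _ n])
  ultimately show ?case using P RAR by auto
qed

section \<open>Reality of the spectrum of a symmetric matrix\<close>

lemma symmetric_scalar_prod:
  fixes A :: "'a :: comm_ring_1 mat"
  assumes "A \<in> carrier_mat n n" "transpose_mat A = A" "x \<in> carrier_vec n" "y \<in> carrier_vec n"
  shows "x \<bullet> (A *\<^sub>v y) = (A *\<^sub>v x) \<bullet> y"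
proof -
  have "A *\<^sub>v y \<in> carrier_vec n" using assms by simp
  then show ?thesis
    using transpose_vec_mult_scalar[OF assms(1,4,3)] comm_scalar_prod[OF assms(3)] assms(2) by simp
qed

text \<open>Evaluating the product of \<open>conjugate v\<close> with \<open>A v\<close> from either
  side gives both \<mu> and its conjugate times the squared norm of \<open>v\<close>, which is
  nonzero. A real matrix commutes with conjugation.\<close>

lemma complex_eigenvalue_symmetric_real:
  fixes A :: "real mat"
  assumes A: "A \<in> carrier_mat n n" and sym: "transpose_mat A = A"
    and ev: "eigenvalue (map_mat complex_of_real A) \<mu>"
  shows "\<mu> \<in> \<real>"
proof -
  let ?A = "map_mat complex_of_real A"
  have cA: "?A \<in> carrier_mat n n" using A by simp
  have symc: "transpose_mat ?A = ?A" using sym by (metis map_mat_transpose)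
  obtain v where v: "v \<in> carrier_vec n" "v \<noteq> 0\<^sub>v n" "?A *\<^sub>v v = \<mu> \<cdot>\<^sub>v v"
    using ev A unfolding eigenvalue_def eigenvector_def by auto
  have cv: "conjugate v \<in> carrier_vec n" using v(1) by simp
  have Acv: "?A *\<^sub>v conjugate v = conjugate (?A *\<^sub>v v)"
    using A v(1) by (intro eq_vecI) (auto simp: scalar_prod_def cnj_sum)
  have "\<mu> * (conjugate v \<bullet> v) = conjugate v \<bullet> (?A *\<^sub>v v)"
    using v cv by simp
  also have "\<dots> = conjugate (?A *\<^sub>v v) \<bullet> v"
    using symmetric_scalar_prod[OF cA symc cv v(1)] by (simp add: Acv)
  also have "\<dots> = cnj \<mu> * (conjugate v \<bullet> v)"
    using v cv by (simp add: conjugate_smult_vec)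
  finally have "(\<mu> - cnj \<mu>) * (conjugate v \<bullet> v) = 0" by (simp add: algebra_simps)
  moreover have "conjugate v \<bullet> v \<noteq> 0"
    using conjugate_square_eq_0_vec[OF v(1)] v(1,2) cv comm_scalar_prod[OF cv v(1)] by simp
  ultimately have "cnj \<mu> = \<mu>" by simp
  then show ?thesis by (simp add: Reals_cnj_iff)
qed

text \<open>The polynomial splits over the complex numbers and all roots are real, so the
  factorization descends along the injective embedding of real polynomials.\<close>

lemma char_poly_real_symmetric_splits:
  fixes A :: "real mat"
  assumes A: "A \<in> carrier_mat n n" and sym: "transpose_mat A = A"
  obtains es where "char_poly A = (\<Prod>e\<leftarrow>es. [:- e, 1:])" "length es = n"
proof -
  interpret r: map_poly_inj_comm_ring_hom complex_of_real ..
  let ?A = "map_mat complex_of_real A" and ?r = "map_poly complex_of_real"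
  have cA: "?A \<in> carrier_mat n n" using A by simp
  obtain as where as: "char_poly ?A = (\<Prod>a\<leftarrow>as. [:- a, 1:])" "length as = n"
    using char_poly_factorized[OF cA] by blast
  have real: "complex_of_real (Re a) = a" if "a \<in> set as" for a
  proof -
    have "poly (char_poly ?A) a = 0"
      unfolding as(1) using that by (auto simp: poly_prod_list prod_list_zero_iff)
    then have "a \<in> \<real>"
      using complex_eigenvalue_symmetric_real[OF A sym] eigenvalue_root_char_poly[OF cA] by blast
    then show ?thesis by simp
  qed
  have "?r (\<Prod>e\<leftarrow>map Re as. [:- e, 1:]) = (\<Prod>a\<leftarrow>as. [:- a, 1:])"
    using real
  proof (induction as)
    case (Cons a as)
    have "?r [:- Re a, 1:] = [:- a, 1:]" using Cons.prems[of a] by simp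
    moreover have "?r (\<Prod>e\<leftarrow>map Re as. [:- e, 1:]) = (\<Prod>a\<leftarrow>as. [:- a, 1:])"
      using Cons.IH Cons.prems by simp
    ultimately show ?case
      by (simp add: r.hom_mult del: mult_pCons_left)
  qed simp
  also have "\<dots> = ?r (char_poly A)"
    using as(1) by (simp add: of_real_hom.char_poly_hom[OF A])
  finally have "char_poly A = (\<Prod>e\<leftarrow>map Re as. [:- e, 1:])" by (simp only: r.eq_iff)
  then show ?thesis using that as(2) by (metis length_map)
qed

lemma sorted_list_of_proots_prod_linear:
  "sorted_list_of_multiset (proots (\<Prod>e\<leftarrow>es. [:- e, 1:])) = sort (es :: real list)"
proof -
  have "proots (\<Prod>e\<leftarrow>es. [:- e, 1:]) = mset es"
  proof (induction es)
    case (Cons e es)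
    have "(\<Prod>e\<leftarrow>es. [:- e, 1:]) \<noteq> 0" by (auto simp: prod_list_zero_iff)
    then show ?case using Cons by (simp add: proots_mult del: mult_pCons_left)
  qed simp
  then show ?thesis by simp
qed

section \<open>The ordered spectrum and variational bounds for its second entry\<close>

definition sorted_eigenvalues :: "real mat \<Rightarrow> real list" where
  "sorted_eigenvalues A = sorted_list_of_multiset (proots (char_poly A))"

context
  fixes A :: "real mat" and n :: nat
  assumes A: "A \<in> carrier_mat n n" and sym: "transpose_mat A = A"
begin

lemma
  shows char_poly_sorted_eigenvalues: "char_poly A = (\<Prod>e\<leftarrow>sorted_eigenvalues A. [:- e, 1:])"
    and length_sorted_eigenvalues: "length (sorted_eigenvalues A) = n"
proof -
  obtain es where es: "char_poly A = (\<Prod>e\<leftarrow>es. [:- e, 1:])" "length es = n"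
    by (rule char_poly_real_symmetric_splits[OF A sym])
  have "sorted_eigenvalues A = sort es"
    unfolding sorted_eigenvalues_def es(1) by (rule sorted_list_of_proots_prod_linear)
  moreover have "(\<Prod>e\<leftarrow>sort es. [:- e, 1:]) = (\<Prod>e\<leftarrow>es. [:- e, 1:])"
    unfolding prod_mset_prod_list[symmetric] by simp
  ultimately show "char_poly A = (\<Prod>e\<leftarrow>sorted_eigenvalues A. [:- e, 1:])"
    "length (sorted_eigenvalues A) = n"
    using es by auto
qed

lemma sorted_sorted_eigenvalues: "sorted (sorted_eigenvalues A)"
  by (simp add: sorted_eigenvalues_def)

lemma eigenvalue_sorted_eigenvalues:
  assumes "i < n"
  shows "eigenvalue A (sorted_eigenvalues A ! i)"
proof -
  have "sorted_eigenvalues A ! i \<in> set (sorted_eigenvalues A)"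
    using assms by (simp add: length_sorted_eigenvalues)
  then have "poly (char_poly A) (sorted_eigenvalues A ! i) = 0"
    by (subst char_poly_sorted_eigenvalues) (auto simp: poly_prod_list prod_list_zero_iff)
  then show ?thesis using eigenvalue_root_char_poly[OF A] by blast
qed

text \<open>The columns of \<open>P\<close> are orthonormal eigenvectors in increasing order of
  eigenvalue and \<open>c\<close> holds coordinates in this basis. The variational bounds thus
  become comparisons of weighted sums of squares.\<close>

lemma quadratic_form_in_eigenbasis:
  obtains P where "P \<in> carrier_mat n n" "transpose_mat P * P = 1\<^sub>m n"
    "\<forall>c\<in>carrier_vec n. (P *\<^sub>v c) \<bullet> (P *\<^sub>v c) = (\<Sum>i<n. (c $ i)\<^sup>2)"
    "\<forall>c\<in>carrier_vec n.
      (P *\<^sub>v c) \<bullet> (A *\<^sub>v (P *\<^sub>v c)) = (\<Sum>i<n. sorted_eigenvalues A ! i * (c $ i)\<^sup>2)"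
proof -
  obtain P where P: "P \<in> carrier_mat n n" and PP: "transpose_mat P * P = 1\<^sub>m n"
    and D: "transpose_mat P * A * P = mat_diag n (\<lambda>i. sorted_eigenvalues A ! i)"
    using real_symmetric_diagonalization[OF A sym char_poly_sorted_eigenvalues] by blast
  have tr: "(P *\<^sub>v c) \<bullet> (P *\<^sub>v d) = c \<bullet> d" if "c \<in> carrier_vec n" "d \<in> carrier_vec n" for c d
  proof -
    have "(P *\<^sub>v c) \<bullet> (P *\<^sub>v d) = c \<bullet> (transpose_mat P *\<^sub>v (P *\<^sub>v d))"
      using transpose_vec_mult_scalar[of P n n c "P *\<^sub>v d"] P that
      by (metis comm_scalar_prod mult_mat_vec_carrier transpose_carrier_mat)
    also have "transpose_mat P *\<^sub>v (P *\<^sub>v d) = (transpose_mat P * P) *\<^sub>v d"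
      using P that by (metis assoc_mult_mat_vec transpose_carrier_mat)
    finally show ?thesis using that by (simp add: PP)
  qed
  have "(P *\<^sub>v c) \<bullet> (P *\<^sub>v c) = (\<Sum>i<n. (c $ i)\<^sup>2)" if "c \<in> carrier_vec n" for c
    using that unfolding tr[OF that that]
    by (simp add: scalar_prod_def power2_eq_square lessThan_atLeast0)
  moreover have "(P *\<^sub>v c) \<bullet> (A *\<^sub>v (P *\<^sub>v c)) = (\<Sum>i<n. sorted_eigenvalues A ! i * (c $ i)\<^sup>2)"
    if c: "c \<in> carrier_vec n" for c
  proof -
    have Pc: "P *\<^sub>v c \<in> carrier_vec n" using P c by simp
    have "(P *\<^sub>v c) \<bullet> (A *\<^sub>v (P *\<^sub>v c)) = c \<bullet> (transpose_mat P *\<^sub>v (A *\<^sub>v (P *\<^sub>v c)))"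
      using transpose_vec_mult_scalar[of P n n c "A *\<^sub>v (P *\<^sub>v c)"] P c A
      by (metis comm_scalar_prod mult_mat_vec_carrier transpose_carrier_mat)
    also have "transpose_mat P *\<^sub>v (A *\<^sub>v (P *\<^sub>v c)) = (transpose_mat P * A * P) *\<^sub>v c"
      using P c A Pc assoc_mult_mat_vec[of "transpose_mat P" n n A n "P *\<^sub>v c"]
        assoc_mult_mat_vec[of "transpose_mat P * A" n n P n c] by simp
    also have "c \<bullet> \<dots> = (\<Sum>i<n. sorted_eigenvalues A ! i * (c $ i)\<^sup>2)"
    proof -
      have "(mat_diag n (\<lambda>i. sorted_eigenvalues A ! i) *\<^sub>v c) $ i = sorted_eigenvalues A ! i * c $ i"
        if "i < n" for i
        using that c by (simp add: mat_diag_def scalar_prod_def if_distrib if_distribR sum.delta cong: if_cong)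
      then show ?thesis
        unfolding D using c
        by (simp add: scalar_prod_def[of c] power2_eq_square lessThan_atLeast0 mat_diag_def ac_simps)
    qed
    finally show ?thesis .
  qed
  ultimately show ?thesis using P PP that by blast
qed

text \<open>
  The first half of the Courant-Fischer bound: among the combinations of the first two eigenvectors
  one is orthogonal to \<open>w\<close>.
\<close>

lemma second_eigenvalue_ge_orthogonal:
  assumes n: "n \<ge> 2" and w: "w \<in> carrier_vec n"
  obtains x where "x \<in> carrier_vec n" "x \<noteq> 0\<^sub>v n" "x \<bullet> w = 0"
    "x \<bullet> (A *\<^sub>v x) \<le> sorted_eigenvalues A ! 1 * (x \<bullet> x)"
proof -
  let ?e = "\<lambda>i. sorted_eigenvalues A ! i"
  obtain P where P: "P \<in> carrier_mat n n" and "transpose_mat P * P = 1\<^sub>m n"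
    and norm: "\<forall>c\<in>carrier_vec n. (P *\<^sub>v c) \<bullet> (P *\<^sub>v c) = (\<Sum>i<n. (c $ i)\<^sup>2)"
    and quad: "\<forall>c\<in>carrier_vec n.
      (P *\<^sub>v c) \<bullet> (A *\<^sub>v (P *\<^sub>v c)) = (\<Sum>i<n. ?e i * (c $ i)\<^sup>2)"
    using quadratic_form_in_eigenbasis by blast
  define u where "u = transpose_mat P *\<^sub>v w"
  have u: "u \<in> carrier_vec n" using P w by (simp add: u_def)
  \<comment> \<open>With \<open>u\<close> the coordinates of \<open>w\<close>, the pair
    (\<open>u $ 1\<close>, \<open>- u $ 0\<close>) is orthogonal to (\<open>u $ 0\<close>,
    \<open>u $ 1\<close>). If both entries vanish, every pair is orthogonal and (1, 0) is
    taken.\<close>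
  define a where "a = (if u $ 0 = 0 \<and> u $ 1 = 0 then 1 else u $ 1)"
  define b where "b = (if u $ 0 = 0 \<and> u $ 1 = 0 then 0 else - u $ 0)"
  have ab: "a * u $ 0 + b * u $ 1 = 0" "a\<^sup>2 + b\<^sup>2 > 0"
    by (auto simp: a_def b_def sum_power2_gt_zero_iff)
  define c where "c = vec n (\<lambda>i. if i = 0 then a else if i = 1 then b else 0)"
  have c: "c \<in> carrier_vec n" by (simp add: c_def)
  have split: "(\<Sum>i<n. f i) = f 0 + f 1 + (\<Sum>i=2..<n. f i)" for f :: "nat \<Rightarrow> real"
    using n sum.atLeastLessThan_concat[of 0 2 n f]
    by (simp add: lessThan_atLeast0 numeral_2_eq_2)
  have nc: "(P *\<^sub>v c) \<bullet> (P *\<^sub>v c) = a\<^sup>2 + b\<^sup>2"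
    unfolding norm[rule_format, OF c] split using n by (simp add: c_def)
  have qc: "(P *\<^sub>v c) \<bullet> (A *\<^sub>v (P *\<^sub>v c)) = ?e 0 * a\<^sup>2 + ?e 1 * b\<^sup>2"
    unfolding quad[rule_format, OF c] split using n by (simp add: c_def)
  have "?e 0 \<le> ?e 1"
    using sorted_nth_mono[OF sorted_sorted_eigenvalues, of 0 1] n
    by (simp add: length_sorted_eigenvalues)
  then have "(P *\<^sub>v c) \<bullet> (A *\<^sub>v (P *\<^sub>v c)) \<le> ?e 1 * ((P *\<^sub>v c) \<bullet> (P *\<^sub>v c))"
    unfolding qc nc by (simp add: algebra_simps mult_right_mono)
  moreover have "(P *\<^sub>v c) \<bullet> w = 0"
  proof -
    have "(P *\<^sub>v c) \<bullet> w = u \<bullet> c"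
      using transpose_vec_mult_scalar[OF P c w] P c w
      by (metis comm_scalar_prod mult_mat_vec_carrier u_def)
    also have "\<dots> = a * u $ 0 + b * u $ 1"
      using c by (simp add: scalar_prod_def lessThan_atLeast0[symmetric] split) (use n in \<open>simp add: c_def\<close>)
    finally show ?thesis using ab by simp
  qed
  moreover have "P *\<^sub>v c \<noteq> 0\<^sub>v n"
    using nc ab(2) by (metis less_irrefl scalar_prod_left_zero zero_carrier_vec)
  ultimately show ?thesis using that[of "P *\<^sub>v c"] P c by simp
qed

text \<open>
  The second half: every two-dimensional space contains a vector orthogonal to the first
  eigenvector.
\<close>

lemma second_eigenvalue_le_two_dim:
  assumes n: "n \<ge> 2" and u: "u \<in> carrier_vec n" and w: "w \<in> carrier_vec n"
  obtains a b where "(a, b) \<noteq> (0, 0)"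
    "\<And>x. x = a \<cdot>\<^sub>v u + b \<cdot>\<^sub>v w \<Longrightarrow> sorted_eigenvalues A ! 1 * (x \<bullet> x) \<le> x \<bullet> (A *\<^sub>v x)"
proof -
  let ?e = "\<lambda>i. sorted_eigenvalues A ! i"
  obtain P where P: "P \<in> carrier_mat n n" and PP: "transpose_mat P * P = 1\<^sub>m n"
    and norm: "\<forall>c\<in>carrier_vec n. (P *\<^sub>v c) \<bullet> (P *\<^sub>v c) = (\<Sum>i<n. (c $ i)\<^sup>2)"
    and quad: "\<forall>c\<in>carrier_vec n.
      (P *\<^sub>v c) \<bullet> (A *\<^sub>v (P *\<^sub>v c)) = (\<Sum>i<n. ?e i * (c $ i)\<^sup>2)"
    using quadratic_form_in_eigenbasis by blast
  have P': "transpose_mat P \<in> carrier_mat n n" using P by simp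
  have PP': "P * transpose_mat P = 1\<^sub>m n" by (rule mat_mult_left_right_inverse[OF P' P PP])
  define u' w' where "u' = transpose_mat P *\<^sub>v u" and "w' = transpose_mat P *\<^sub>v w"
  \<comment> \<open>The pair is chosen so that the coordinate along the first eigenvector cancels.
    As \<open>u\<close> and \<open>w\<close> may be dependent, only the pair is guaranteed to be
    nonzero, not the combination.\<close>
  define a where "a = (if u' $ 0 = 0 \<and> w' $ 0 = 0 then 1 else w' $ 0)"
  define b where "b = (if u' $ 0 = 0 \<and> w' $ 0 = 0 then 0 else - u' $ 0)"
  have ab: "a * u' $ 0 + b * w' $ 0 = 0" "(a, b) \<noteq> (0, 0)"
    by (auto simp: a_def b_def)
  define c where "c = transpose_mat P *\<^sub>v (a \<cdot>\<^sub>v u + b \<cdot>\<^sub>v w)"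
  have c: "c \<in> carrier_vec n" using P u w by (simp add: c_def)
  have ceq: "c = a \<cdot>\<^sub>v u' + b \<cdot>\<^sub>v w'"
    unfolding c_def u'_def w'_def using P' u w
    by (simp add: mult_add_distrib_mat_vec[of _ n n] mult_mat_vec[of _ n n])
  have c0: "c $ 0 = 0"
    unfolding ceq using ab(1) P' u w n by (simp add: u'_def w'_def)
  have Pc: "P *\<^sub>v c = a \<cdot>\<^sub>v u + b \<cdot>\<^sub>v w"
    unfolding c_def using assoc_mult_mat_vec[OF P P', of "a \<cdot>\<^sub>v u + b \<cdot>\<^sub>v w"] u w by (simp add: PP')
  \<comment> \<open>Only the eigenvalue with index 0 can lie below \<open>?e 1\<close>, and its
    coefficient is zero.\<close>
  have "?e 1 * (\<Sum>i<n. (c $ i)\<^sup>2) \<le> (\<Sum>i<n. ?e i * (c $ i)\<^sup>2)"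
    unfolding sum_distrib_left
  proof (rule sum_mono)
    fix i assume i: "i \<in> {..<n}"
    show "?e 1 * (c $ i)\<^sup>2 \<le> ?e i * (c $ i)\<^sup>2"
    proof (cases "i = 0")
      case False
      then have "?e 1 \<le> ?e i"
        using sorted_nth_mono[OF sorted_sorted_eigenvalues, of 1 i] i
        by (simp add: length_sorted_eigenvalues)
      then show ?thesis by (simp add: mult_right_mono)
    qed (simp add: c0)
  qed
  then show ?thesis
    using that[of a b] ab(2) norm[rule_format, OF c] quad[rule_format, OF c] unfolding Pc by simp
qed

end

section \<open>The Laplacian as an operator on functions\<close>

text \<open>Acting on functions avoids the arbitrary enumeration of vertices behind the matrix;
  \<open>laplacian_mult_vec_of\<close> connects the two.\<close>

definition graph_laplacian :: "'a pair_pre_digraph \<Rightarrow> ('a \<Rightarrow> real) \<Rightarrow> 'a \<Rightarrow> real" where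
  "graph_laplacian \<Gamma> f u = (\<Sum>v | (u, v) \<in> parcs \<Gamma>. f u - f v)"

context pair_graph
begin

abbreviation V :: "'a set" where "V \<equiv> pverts G"
abbreviation E :: "('a \<times> 'a) set" where "E \<equiv> parcs G"
abbreviation N :: nat where "N \<equiv> card V"
abbreviation \<Delta> :: "('a \<Rightarrow> real) \<Rightarrow> 'a \<Rightarrow> real" where "\<Delta> \<equiv> graph_laplacian G"

lemma finite_V [simp]: "finite V" by (rule pair_finite_verts)
lemma finite_E [simp]: "finite E" by (rule pair_finite_arcs)
lemma E_sym: "(u, v) \<in> E \<Longrightarrow> (v, u) \<in> E" by (rule arcs_symmetric)
lemma E_irrefl [simp]: "(u, u) \<notin> E" using no_loops'[of u u] by auto
lemma E_in_V: "(u, v) \<in> E \<Longrightarrow> u \<in> V" "(u, v) \<in> E \<Longrightarrow> v \<in> V"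
  using in_arcsD1 in_arcsD2 by blast+
lemma finite_nbrs [simp]: "finite {v. (u, v) \<in> E}"
  by (rule finite_subset[OF _ finite_V]) (auto dest: E_in_V)

section \<open>Functions on the vertices as vectors\<close>

lemma distinct_vertex_list: "distinct (vertex_list G)"
  and set_vertex_list: "set (vertex_list G) = V"
proof -
  have "\<exists>vs. distinct vs \<and> set vs = V"
    using finite_distinct_list[OF finite_V] by blast
  from someI_ex[OF this] show "distinct (vertex_list G)" "set (vertex_list G) = V"
    by (auto simp: vertex_list_def)
qed

lemma length_vertex_list: "length (vertex_list G) = N"
  using distinct_card[OF distinct_vertex_list] by (simp add: set_vertex_list)

lemma bij_vertex_list: "bij_betw ((!) (vertex_list G)) {0..<N} V"
  by (rule bij_betw_nth[OF distinct_vertex_list])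
     (auto simp: length_vertex_list set_vertex_list)

definition vec_of :: "('a \<Rightarrow> real) \<Rightarrow> real vec" where
  "vec_of f = vec N (\<lambda>i. f (vertex_list G ! i))"

lemma vec_of_carrier [simp]: "vec_of f \<in> carrier_vec N"
  by (simp add: vec_of_def)

lemma vec_of_exhaust:
  assumes "x \<in> carrier_vec N"
  obtains f where "x = vec_of f"
proof -
  have "x = vec_of (\<lambda>v. x $ inv_into {0..<N} ((!) (vertex_list G)) v)"
    using assms bij_betw_inv_into_left[OF bij_vertex_list]
    by (intro eq_vecI) (auto simp: vec_of_def)
  then show ?thesis by (rule that)
qed

lemma vec_of_eq_iff: "vec_of f = vec_of g \<longleftrightarrow> (\<forall>v\<in>V. f v = g v)"
proof -
  have "vec_of f = vec_of g \<longleftrightarrow> (\<forall>i\<in>{0..<N}. f (vertex_list G ! i) = g (vertex_list G ! i))"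
    by (auto simp: vec_of_def vec_eq_iff)
  also have "\<dots> \<longleftrightarrow> (\<forall>v\<in>(!) (vertex_list G) ` {0..<N}. f v = g v)" by blast
  also have "(!) (vertex_list G) ` {0..<N} = V" using bij_vertex_list by (simp add: bij_betw_def)
  finally show ?thesis .
qed

lemma vec_of_eq_0_iff: "vec_of f = 0\<^sub>v N \<longleftrightarrow> (\<forall>v\<in>V. f v = 0)"
proof -
  have "0\<^sub>v N = vec_of (\<lambda>_. 0)" by (auto simp: vec_of_def)
  then show ?thesis by (simp add: vec_of_eq_iff)
qed

lemma sum_vertex_list: "(\<Sum>i = 0..<N. g (vertex_list G ! i)) = sum g V"
  by (rule sum.reindex_bij_betw[OF bij_vertex_list])

lemma vec_of_scalar_prod: "vec_of f \<bullet> vec_of g = (\<Sum>v\<in>V. f v * g v)"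
  using sum_vertex_list[of "\<lambda>v. f v * g v"] by (simp add: vec_of_def scalar_prod_def)

lemma vec_of_smult: "c \<cdot>\<^sub>v vec_of f = vec_of (\<lambda>v. c * f v)"
  and vec_of_add: "vec_of f + vec_of g = vec_of (\<lambda>v. f v + g v)"
  by (auto simp: vec_of_def)

lemma laplacian_carrier: "laplacian G \<in> carrier_mat N N"
  by (auto simp: laplacian_def degree_matrix_def adjacency_matrix_def mat_diag_def)

lemma out_degree_with_proj: "out_degree (with_proj G) u = card {v. (u, v) \<in> E}"
proof -
  have "out_arcs (with_proj G) u = (\<lambda>v. (u, v)) ` {v. (u, v) \<in> E}"
    by (auto simp: out_arcs_def)
  then show ?thesis by (simp add: out_degree_def card_image inj_on_def)
qed

lemma laplacian_index:
  assumes "i < N" "j < N"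
  shows "laplacian G $$ (i, j) =
    (if i = j then real (card {v. (vertex_list G ! i, v) \<in> E}) else 0) -
    (if (vertex_list G ! i, vertex_list G ! j) \<in> E then 1 else 0)"
  using assms
  by (simp add: laplacian_def degree_matrix_def adjacency_matrix_def mat_diag_def out_degree_with_proj)

lemma transpose_laplacian: "transpose_mat (laplacian G) = laplacian G"
  using laplacian_carrier
  by (intro eq_matI) (auto simp: laplacian_index dest: E_sym)

lemma graph_laplacian_eq:
  "\<Delta> f u = real (card {v. (u, v) \<in> E}) * f u - (\<Sum>v | (u, v) \<in> E. f v)"
  by (simp add: graph_laplacian_def sum_subtractf)

lemma laplacian_mult_vec_of: "laplacian G *\<^sub>v vec_of f = vec_of (\<Delta> f)"
proof (rule eq_vecI)
  fix i assume "i < dim_vec (vec_of (\<Delta> f))"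
  then have i: "i < N" by (simp add: vec_of_def)
  let ?u = "vertex_list G ! i"
  have "(laplacian G *\<^sub>v vec_of f) $ i = (\<Sum>j = 0..<N. laplacian G $$ (i, j) * f (vertex_list G ! j))"
    using i laplacian_carrier by (simp add: scalar_prod_def vec_of_def)
  also have "\<dots> = (\<Sum>j = 0..<N. (if i = j then card {v. (?u, v) \<in> E} * f (vertex_list G ! j) else 0) -
      (if (?u, vertex_list G ! j) \<in> E then f (vertex_list G ! j) else 0))"
    using i by (intro sum.cong) (auto simp: laplacian_index algebra_simps)
  also have "\<dots> = card {v. (?u, v) \<in> E} * f ?u - (\<Sum>v\<in>V. if (?u, v) \<in> E then f v else 0)"
    using i sum_vertex_list[of "\<lambda>v. if (?u, v) \<in> E then f v else 0"]
    by (simp add: sum_subtractf)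
  also have "(\<Sum>v\<in>V. if (?u, v) \<in> E then f v else 0) = (\<Sum>v | (?u, v) \<in> E. f v)"
    by (rule sum.mono_neutral_cong_right) (auto dest: E_in_V)
  finally show "(laplacian G *\<^sub>v vec_of f) $ i = vec_of (\<Delta> f) $ i"
    using i by (simp add: vec_of_def graph_laplacian_eq)
qed (use laplacian_carrier in \<open>simp add: vec_of_def\<close>)

lemma eigenvalue_laplacian_iff:
  "eigenvalue (laplacian G) c \<longleftrightarrow> (\<exists>f. (\<exists>u\<in>V. f u \<noteq> 0) \<and> (\<forall>u\<in>V. \<Delta> f u = c * f u))"
  (is "?l \<longleftrightarrow> ?r")
proof
  assume ?l
  then obtain x where x: "x \<in> carrier_vec N" "x \<noteq> 0\<^sub>v N" "laplacian G *\<^sub>v x = c \<cdot>\<^sub>v x"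
    using laplacian_carrier unfolding eigenvalue_def eigenvector_def by auto
  obtain f where "x = vec_of f" by (rule vec_of_exhaust[OF x(1)])
  then show ?r
    using x(2,3) by (auto simp: laplacian_mult_vec_of vec_of_smult vec_of_eq_iff vec_of_eq_0_iff)
next
  assume ?r
  then obtain f where "\<exists>u\<in>V. f u \<noteq> 0" "\<forall>u\<in>V. \<Delta> f u = c * f u" by blast
  then have "eigenvector (laplacian G) (vec_of f) c"
    using laplacian_carrier
    by (auto simp: eigenvector_def laplacian_mult_vec_of vec_of_smult vec_of_eq_iff vec_of_eq_0_iff)
  then show ?l by (auto simp: eigenvalue_def)
qed

section \<open>The Dirichlet form\<close>

lemma sum_nbrs: "(\<Sum>u\<in>V. \<Sum>v | (u, v) \<in> E. g u v) = (\<Sum>(u, v)\<in>E. g u v)"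
  by (subst sum.Sigma) (auto intro!: sum.cong dest: E_in_V)

lemma sum_E_swap: "(\<Sum>(u, v)\<in>E. g u v) = (\<Sum>(u, v)\<in>E. g v u)"
  by (rule sum.reindex_bij_witness[of _ prod.swap prod.swap]) (auto intro: E_sym)

text \<open>The two orientations of each edge contribute opposite differences.\<close>

lemma sum_graph_laplacian: "(\<Sum>u\<in>V. \<Delta> f u) = 0"
proof -
  have "(\<Sum>u\<in>V. \<Delta> f u) = (\<Sum>(u, v)\<in>E. f u - f v)"
    unfolding graph_laplacian_def by (rule sum_nbrs)
  also have "\<dots> = (\<Sum>(u, v)\<in>E. f u) - (\<Sum>(u, v)\<in>E. f v)"
    by (simp add: sum_subtractf case_prod_unfold)
  also have "\<dots> = 0" using sum_E_swap[of "\<lambda>u v. f u"] by simp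
  finally show ?thesis .
qed

text \<open>Add the sum over arcs to the sum over reversed arcs. The factor 2 appears because each
  undirected edge is a pair of arcs.\<close>

lemma dirichlet_form: "2 * (\<Sum>u\<in>V. f u * \<Delta> f u) = (\<Sum>(u, v)\<in>E. (f u - f v)\<^sup>2)"
proof -
  have *: "(\<Sum>u\<in>V. f u * \<Delta> f u) = (\<Sum>(u, v)\<in>E. f u * (f u - f v))"
    unfolding graph_laplacian_def sum_distrib_left by (rule sum_nbrs)
  have "(\<Sum>u\<in>V. f u * \<Delta> f u) + (\<Sum>u\<in>V. f u * \<Delta> f u) =
      (\<Sum>(u, v)\<in>E. f u * (f u - f v)) + (\<Sum>(u, v)\<in>E. f v * (f v - f u))"
    unfolding * using sum_E_swap[of "\<lambda>u v. f u * (f u - f v)"] by simp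
  also have "\<dots> = (\<Sum>(u, v)\<in>E. (f u - f v)\<^sup>2)"
    unfolding sum.distrib[symmetric] by (intro sum.cong) (auto simp: power2_eq_square algebra_simps)
  finally show ?thesis by simp
qed

text \<open>Selecting at most one orientation of each edge makes \<open>D\<close> and its converse
  disjoint, which accounts for the factor 2; the remaining arcs contribute nonnegative terms. Lower
  bounds on the spectrum come from stars of edges chosen as \<open>D\<close>.\<close>

lemma dirichlet_form_ge:
  assumes "D \<subseteq> E" and asym: "\<And>u v. (u, v) \<in> D \<Longrightarrow> (v, u) \<notin> D"
  shows "(\<Sum>(u, v)\<in>D. (f u - f v)\<^sup>2) \<le> (\<Sum>u\<in>V. f u * \<Delta> f u)"
proof -
  have fin: "finite D" using assms(1) finite_E by (rule finite_subset)
  have "(\<Sum>(u, v)\<in>D\<inverse>. (f u - f v)\<^sup>2) = (\<Sum>(u, v)\<in>D. (f u - f v)\<^sup>2)"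
    by (rule sum.reindex_bij_witness[of _ prod.swap prod.swap]) (auto simp: power2_commute)
  then have "2 * (\<Sum>(u, v)\<in>D. (f u - f v)\<^sup>2) = (\<Sum>(u, v)\<in>D \<union> D\<inverse>. (f u - f v)\<^sup>2)"
    using fin asym by (subst sum.union_disjoint) auto
  also have "\<dots> \<le> (\<Sum>(u, v)\<in>E. (f u - f v)\<^sup>2)"
    using assms(1) by (intro sum_mono2) (auto intro: E_sym)
  also have "\<dots> = 2 * (\<Sum>u\<in>V. f u * \<Delta> f u)" by (rule dirichlet_form[symmetric])
  finally show ?thesis by simp
qed

section \<open>Rayleigh quotients and the algebraic connectivity\<close>

lemma algebraic_connectivity_eq:
  "algebraic_connectivity G = sorted_eigenvalues (laplacian G) ! 1"
  by (simp add: algebraic_connectivity_def laplacian_eigenvalues_def sorted_eigenvalues_def)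

lemma eigenvalue_algebraic_connectivity:
  "N \<ge> 2 \<Longrightarrow> eigenvalue (laplacian G) (algebraic_connectivity G)"
  unfolding algebraic_connectivity_eq
  by (rule eigenvalue_sorted_eigenvalues[OF laplacian_carrier transpose_laplacian]) simp

text \<open>Orthogonality to the constant function 1 is the condition of sum zero.\<close>

lemma algebraic_connectivity_ge_rayleigh:
  assumes "N \<ge> 2"
  obtains f where "\<exists>u\<in>V. f u \<noteq> 0" "(\<Sum>u\<in>V. f u) = 0"
    "(\<Sum>u\<in>V. f u * \<Delta> f u) \<le> algebraic_connectivity G * (\<Sum>u\<in>V. (f u)\<^sup>2)"
proof -
  obtain x where x: "x \<in> carrier_vec N" "x \<noteq> 0\<^sub>v N" "x \<bullet> vec_of (\<lambda>_. 1) = 0"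
    "x \<bullet> (laplacian G *\<^sub>v x) \<le> sorted_eigenvalues (laplacian G) ! 1 * (x \<bullet> x)"
    by (rule second_eigenvalue_ge_orthogonal[OF laplacian_carrier transpose_laplacian assms vec_of_carrier])
  obtain f where f: "x = vec_of f" by (rule vec_of_exhaust[OF x(1)])
  show ?thesis
    using that[of f] x(2-)
    by (simp add: f vec_of_eq_0_iff laplacian_mult_vec_of vec_of_scalar_prod algebraic_connectivity_eq power2_eq_square)
qed

text \<open>Apply the two-dimensional bound to the span of the constant 1 and \<open>f\<close>.
  Since these are orthogonal and constants have zero energy, the bound for a combination passes to
  \<open>f\<close>.\<close>

lemma algebraic_connectivity_le_rayleigh:
  assumes N: "N \<ge> 2" and pos: "algebraic_connectivity G > 0" and sum0: "(\<Sum>u\<in>V. f u) = 0"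
  shows "algebraic_connectivity G * (\<Sum>u\<in>V. (f u)\<^sup>2) \<le> (\<Sum>u\<in>V. f u * \<Delta> f u)"
proof -
  let ?l = "algebraic_connectivity G"
  obtain a b where ab: "(a, b) \<noteq> (0, 0)"
    and le: "\<And>x. x = a \<cdot>\<^sub>v vec_of (\<lambda>_. 1) + b \<cdot>\<^sub>v vec_of f \<Longrightarrow> ?l * (x \<bullet> x) \<le> x \<bullet> (laplacian G *\<^sub>v x)"
    unfolding algebraic_connectivity_eq
    using second_eigenvalue_le_two_dim[OF laplacian_carrier transpose_laplacian N vec_of_carrier vec_of_carrier]
    by blast
  let ?g = "\<lambda>v. a + b * f v"
  have "\<Delta> ?g u = b * \<Delta> f u" for u
    by (simp add: graph_laplacian_def sum_distrib_left algebra_simps)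
  then have "(\<Sum>u\<in>V. ?g u * \<Delta> ?g u) = (\<Sum>u\<in>V. a * b * \<Delta> f u + b\<^sup>2 * (f u * \<Delta> f u))"
    by (intro sum.cong) (auto simp: power2_eq_square algebra_simps)
  also have "\<dots> = a * b * (\<Sum>u\<in>V. \<Delta> f u) + b\<^sup>2 * (\<Sum>u\<in>V. f u * \<Delta> f u)"
    by (simp add: sum.distrib sum_distrib_left)
  finally have q: "(\<Sum>u\<in>V. ?g u * \<Delta> ?g u) = b\<^sup>2 * (\<Sum>u\<in>V. f u * \<Delta> f u)"
    by (simp add: sum_graph_laplacian)
  have "(\<Sum>u\<in>V. ?g u * ?g u) = (\<Sum>u\<in>V. a\<^sup>2 + 2 * a * b * f u + b\<^sup>2 * (f u)\<^sup>2)"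
    by (intro sum.cong) (auto simp: power2_eq_square algebra_simps)
  also have "\<dots> = N * a\<^sup>2 + 2 * a * b * (\<Sum>u\<in>V. f u) + b\<^sup>2 * (\<Sum>u\<in>V. (f u)\<^sup>2)"
    by (simp add: sum.distrib sum_distrib_left)
  finally have n: "(\<Sum>u\<in>V. ?g u * ?g u) = N * a\<^sup>2 + b\<^sup>2 * (\<Sum>u\<in>V. (f u)\<^sup>2)"
    by (simp add: sum0)
  have "a \<cdot>\<^sub>v vec_of (\<lambda>_. 1) + b \<cdot>\<^sub>v vec_of f = vec_of ?g"
    by (simp add: vec_of_smult vec_of_add)
  then have "?l * (N * a\<^sup>2 + b\<^sup>2 * (\<Sum>u\<in>V. (f u)\<^sup>2)) \<le> b\<^sup>2 * (\<Sum>u\<in>V. f u * \<Delta> f u)"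
    using le[of "vec_of ?g"] by (simp add: laplacian_mult_vec_of vec_of_scalar_prod q n)
  then have *: "?l * (N * a\<^sup>2) + b\<^sup>2 * (?l * (\<Sum>u\<in>V. (f u)\<^sup>2)) \<le> b\<^sup>2 * (\<Sum>u\<in>V. f u * \<Delta> f u)"
    by (simp add: algebra_simps)
  \<comment> \<open>Otherwise the combination is a nonzero constant with zero energy, against the
    positive algebraic connectivity.\<close>
  have "b \<noteq> 0"
  proof
    assume "b = 0"
    then have "a \<noteq> 0" using ab by simp
    then have "?l * (N * a\<^sup>2) > 0" using pos N by simp
    then show False using * \<open>b = 0\<close> by simp
  qed
  moreover have "?l * (N * a\<^sup>2) \<ge> 0" using pos by simp
  then have "b\<^sup>2 * (?l * (\<Sum>u\<in>V. (f u)\<^sup>2)) \<le> b\<^sup>2 * (\<Sum>u\<in>V. f u * \<Delta> f u)"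
    using * by linarith
  ultimately show ?thesis by simp
qed

end

section \<open>Graphs shaped like the power graph of a dicyclic group\<close>

text \<open>The arcs are already symmetric, so the symmetric closure in the definition of
  connectedness adds nothing and reachability is the closure of a plain relation.\<close>

lemma (in pair_graph) connected_induced_iff:
  "Digraph_Component.connected (with_proj G \<restriction> W) \<longleftrightarrow>
    W \<noteq> {} \<and> (\<forall>u\<in>W. \<forall>v\<in>W. (u, v) \<in> (E \<inter> W \<times> W)\<^sup>*)"
proof -
  let ?H = "mk_symmetric (with_proj G \<restriction> W)"
  have arcs: "parcs ?H = E \<inter> W \<times> W"
    by (auto simp: parcs_mk_symmetric dest: E_sym)
  have wf: "wf_digraph (with_proj G \<restriction> W)" by (rule wellformed_induce_subgraph)
  interpret H: pair_wf_digraph ?H by (rule wf_digraph.wellformed_mk_symmetric[OF wf])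
  have "arcs_ends (with_proj ?H) = E \<inter> W \<times> W"
    unfolding arcs_ends_conv by (simp add: arcs)
  then have "u \<rightarrow>\<^sup>*\<^bsub>with_proj ?H\<^esub> v \<longleftrightarrow> (u, v) \<in> (E \<inter> W \<times> W)\<^sup>*" if "u \<in> W" for u v
    using H.reachable_conv'[of u v] that by simp
  then show ?thesis by (simp add: Digraph_Component.connected_def strongly_connected_def)
qed

text \<open>What the connectivity and spectral arguments use of the power graph, with the group
  forgotten: \<open>A\<close> is the cyclic subgroup generated by \<open>a\<close>, \<open>B\<close>
  its other coset, \<open>e\<close> the identity, \<open>z\<close> the element \<open>a\<close> to
  the power \<open>n\<close>, and the hub in \<open>A_hub\<close> the generator \<open>a\<close>.
  Other adjacencies inside \<open>A\<close> depend on \<open>n\<close> and are left open.\<close>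

locale dicyclic_like = pair_graph +
  fixes n :: nat and A B :: "'a set" and e z :: 'a
  assumes n_ge_2: "n \<ge> 2"
    and V_eq: "pverts G = A \<union> B" and AB_disjoint: "A \<inter> B = {}"
    and card_A: "card A = 2 * n" and card_B: "card B = 2 * n"
    and e_in_A: "e \<in> A" and z_in_A: "z \<in> A" and e_neq_z: "e \<noteq> z"
    and e_dominating: "v \<in> A \<union> B \<Longrightarrow> v \<noteq> e \<Longrightarrow> (e, v) \<in> parcs G"
    and B_nbrs: "u \<in> B \<Longrightarrow> \<exists>u'\<in>B. u' \<noteq> u \<and> {v. (u, v) \<in> parcs G} = {e, z, u'}"
    and A_hub: "\<exists>g\<in>A - {e, z}. \<forall>v\<in>A - {g}. (g, v) \<in> parcs G"
begin

section \<open>Adjacency between the two halves and vertex connectivity\<close>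

lemma finite_A [simp]: "finite A" and finite_B [simp]: "finite B"
  using V_eq finite_V by (metis finite_Un)+

lemma card_V: "N = 4 * n"
  unfolding V_eq using AB_disjoint by (simp add: card_Un_disjoint card_A card_B)

lemma sum_V: "(\<Sum>v\<in>V. f v) = (\<Sum>v\<in>A. f v) + (\<Sum>v\<in>B. f v)" for f :: "'a \<Rightarrow> real"
  unfolding V_eq using AB_disjoint by (simp add: sum.union_disjoint)

lemma not_in_B: "e \<notin> B" "z \<notin> B"
  using e_in_A z_in_A AB_disjoint by auto

lemma z_adj_B: "u \<in> B \<Longrightarrow> (z, u) \<in> E"
  using B_nbrs[of u] by (auto intro: E_sym)

text \<open>A vertex of \<open>B\<close> has no neighbours outside \<open>B\<close> except
  \<open>e\<close> and \<open>z\<close>, so every edge between the halves ends in one of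
  these.\<close>

lemma A_nbrs_in_A:
  assumes "u \<in> A" "u \<noteq> e" "u \<noteq> z" "(u, v) \<in> E"
  shows "v \<in> A"
proof (rule ccontr)
  assume "v \<notin> A"
  then have "v \<in> B" using assms(4) V_eq E_in_V by blast
  then have "u \<in> B" using B_nbrs[of v] E_sym[OF assms(4)] assms(2,3) by blast
  then show False using assms(1) AB_disjoint by blast
qed

text \<open>If \<open>e\<close> survives, it reaches everything in one step. Otherwise exactly
  \<open>e\<close> was removed and \<open>z\<close> takes over: it is adjacent to all of
  \<open>B\<close> and reaches \<open>A\<close> through the hub.\<close>

lemma connected_remove_one:
  assumes "S \<subseteq> V" "card S < 2"
  shows "Digraph_Component.connected (with_proj G \<restriction> (V - S))"
proof -
  have "finite S" using assms(1) finite_V by (rule finite_subset)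
  let ?W = "V - S" and ?R = "E \<inter> (V - S) \<times> (V - S)"
  obtain g where g: "g \<in> A" "g \<noteq> e" "g \<noteq> z" "\<And>v. v \<in> A \<Longrightarrow> v \<noteq> g \<Longrightarrow> (g, v) \<in> E"
    using A_hub by blast
  have symR: "sym (?R\<^sup>*)" by (intro sym_rtrancl symI) (auto intro: E_sym)
  have "\<exists>c\<in>?W. \<forall>v\<in>?W. (c, v) \<in> ?R\<^sup>*"
  proof (cases "e \<in> S")
    case False
    have "(e, v) \<in> ?R\<^sup>*" if "v \<in> ?W" for v
      using that False e_dominating[of v] e_in_A V_eq by (cases "v = e") auto
    then show ?thesis using False e_in_A V_eq by blast
  next
    case True
    have S: "S = {e}"
    proof (rule ccontr)
      assume "S \<noteq> {e}"
      then obtain s where "s \<in> S" "s \<noteq> e" using True by blast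
      then have "card {e, s} \<le> card S" using True \<open>finite S\<close> by (intro card_mono) auto
      then show False using assms(2) \<open>s \<noteq> e\<close> by simp
    qed
    have zg: "(z, g) \<in> ?R"
      using g z_in_A e_neq_z V_eq by (auto simp: S intro: E_sym)
    have "(z, v) \<in> ?R\<^sup>*" if v: "v \<in> ?W" for v
    proof (cases "v \<in> B")
      case True
      then show ?thesis using v z_adj_B[OF True] z_in_A e_neq_z V_eq by (auto simp: S)
    next
      case False
      then have "v \<in> A" using v V_eq by blast
      then have "v = g \<or> (g, v) \<in> ?R" using v g V_eq by (auto simp: S)
      then show ?thesis using zg by (auto intro: rtrancl_into_rtrancl)
    qed
    then show ?thesis using z_in_A e_neq_z V_eq by (intro bexI[of _ z]) (auto simp: S)
  qed
  then obtain c where "c \<in> ?W" "\<forall>v\<in>?W. (c, v) \<in> ?R\<^sup>*" by blast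
  then have c: "(c, v) \<in> ?R\<^sup>*" if "v \<in> ?W" for v
    using that by auto
  show ?thesis
    unfolding connected_induced_iff
  proof (intro conjI ballI)
    fix u v assume "u \<in> ?W" "v \<in> ?W"
    show "(u, v) \<in> ?R\<^sup>*"
      by (rule rtrancl_trans[OF symD[OF symR c[OF \<open>u \<in> ?W\<close>]] c[OF \<open>v \<in> ?W\<close>]])
  qed (use \<open>c \<in> ?W\<close> in blast)
qed

text \<open>Without \<open>e\<close> and \<open>z\<close>, a walk that starts in \<open>B\<close>
  stays in \<open>B\<close> and never meets the hub.\<close>

lemma disconnected_remove_centre:
  "\<not> Digraph_Component.connected (with_proj G \<restriction> (V - {e, z}))"
proof
  let ?R = "E \<inter> (V - {e, z}) \<times> (V - {e, z})"
  assume "Digraph_Component.connected (with_proj G \<restriction> (V - {e, z}))"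
  then have conn: "\<forall>u\<in>V - {e, z}. \<forall>v\<in>V - {e, z}. (u, v) \<in> ?R\<^sup>*"
    unfolding connected_induced_iff by blast
  obtain g where g: "g \<in> A" "g \<noteq> e" "g \<noteq> z" using A_hub by blast
  obtain u where u: "u \<in> B" using card_B n_ge_2 by fastforce
  have "v \<in> B" if "(u, v) \<in> ?R\<^sup>*" for v
    using that
  proof (induction rule: rtrancl_induct)
    case (step x y)
    then show ?case using B_nbrs[of x] by blast
  qed (rule u)
  moreover have "(u, g) \<in> ?R\<^sup>*" using conn g u V_eq not_in_B by auto
  ultimately show False using g(1) AB_disjoint by blast
qed

lemma vertex_connectivity_eq_2: "vertex_connectivity G = 2"
  unfolding vertex_connectivity_def
proof (rule Least_equality)
  have "V \<noteq> {e, z}" using card_V n_ge_2 e_neq_z by auto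
  then have "{e, z} \<subset> V" using e_in_A z_in_A V_eq by auto
  then show "\<exists>S\<subset>V. card S = 2 \<and>
      (\<not> Digraph_Component.connected (with_proj G \<restriction> (V - S)) \<or> card (V - S) = 1)"
    using disconnected_remove_centre e_neq_z by (intro exI[of _ "{e, z}"]) auto
next
  fix k
  assume "\<exists>S\<subset>V. card S = k \<and>
      (\<not> Digraph_Component.connected (with_proj G \<restriction> (V - S)) \<or> card (V - S) = 1)"
  then obtain S where S: "S \<subset> V" "card S = k"
    "\<not> Digraph_Component.connected (with_proj G \<restriction> (V - S)) \<or> card (V - S) = 1"
    by blast
  show "2 \<le> k"
  proof (rule ccontr)
    assume "\<not> 2 \<le> k"
    \<comment> \<open>Only the one-vertex alternative is left, but at least 4 n - 1 vertices
      remain.\<close>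
    then have "card (V - S) = 1" using S connected_remove_one[of S] by auto
    moreover have "card (V - S) = N - card S"
      using S(1) finite_V by (intro card_Diff_subset) (auto intro: finite_subset)
    ultimately show False using \<open>\<not> 2 \<le> k\<close> S(2) card_V n_ge_2 by simp
  qed
qed

section \<open>Bounds on the algebraic connectivity\<close>

lemma graph_laplacian_nbrs:
  assumes "{v. (u, v) \<in> E} = W - {u}" "finite W"
  shows "\<Delta> f u = (\<Sum>v\<in>W. f u - f v)"
  unfolding graph_laplacian_def assms(1)
  by (rule sum.mono_neutral_left) (use assms(2) in auto)

text \<open>The mixed term vanishes by sum zero. For a dominating vertex \<open>x\<close> this is
  the energy of the star at \<open>x\<close>.\<close>

lemma sum_star_squares:
  assumes "(\<Sum>v\<in>V. f v) = 0"
  shows "(\<Sum>v\<in>V. (f x - f v)\<^sup>2) = real N * (f x)\<^sup>2 + (\<Sum>v\<in>V. (f v)\<^sup>2)"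
proof -
  have "(\<Sum>v\<in>V. (f x - f v)\<^sup>2) = (\<Sum>v\<in>V. (f x)\<^sup>2 - 2 * f x * f v + (f v)\<^sup>2)"
    by (intro sum.cong) (auto simp: power2_diff)
  also have "\<dots> = real N * (f x)\<^sup>2 - 2 * f x * (\<Sum>v\<in>V. f v) + (\<Sum>v\<in>V. (f v)\<^sup>2)"
    by (simp add: sum.distrib sum_subtractf sum_distrib_left)
  finally show ?thesis using assms by simp
qed

lemma sum_star_arcs: "(\<Sum>(u, v)\<in>{x} \<times> W. g u v) = (\<Sum>v\<in>W. g x v)"
  by (simp add: sum.cartesian_product[symmetric])

lemma sum_squares_pos: "\<exists>u\<in>V. f u \<noteq> 0 \<Longrightarrow> (\<Sum>v\<in>V. (f v)\<^sup>2) > 0" for f :: "'a \<Rightarrow> real"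
  by (auto intro!: sum_pos2)

text \<open>Suppose some nonzero \<open>f\<close> of sum zero has Rayleigh quotient at most 1. The
  star at \<open>e\<close> uses up this energy, so \<open>f e = 0\<close> and \<open>f\<close> is
  constant along every edge avoiding \<open>e\<close>. These edges connect the other vertices
  through \<open>z\<close> and the hub, and sum zero then forces \<open>f = 0\<close>.\<close>

lemma algebraic_connectivity_gt_1: "algebraic_connectivity G > 1"
proof (rule ccontr)
  assume "\<not> algebraic_connectivity G > 1"
  obtain f where f: "\<exists>u\<in>V. f u \<noteq> 0" "(\<Sum>u\<in>V. f u) = 0"
    and q: "(\<Sum>u\<in>V. f u * \<Delta> f u) \<le> algebraic_connectivity G * (\<Sum>u\<in>V. (f u)\<^sup>2)"
    using algebraic_connectivity_ge_rayleigh card_V n_ge_2 by auto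
  have "algebraic_connectivity G * (\<Sum>u\<in>V. (f u)\<^sup>2) \<le> 1 * (\<Sum>u\<in>V. (f u)\<^sup>2)"
    using \<open>\<not> algebraic_connectivity G > 1\<close> by (intro mult_right_mono sum_nonneg) auto
  then have q1: "(\<Sum>u\<in>V. f u * \<Delta> f u) \<le> (\<Sum>u\<in>V. (f u)\<^sup>2)" using q by simp
  have edge: "f e = 0 \<and> f u = f v" if uv: "(u, v) \<in> E" "u \<noteq> e" "v \<noteq> e" for u v
  proof -
    let ?D = "insert (u, v) ({e} \<times> (V - {e}))"
    have "(\<Sum>(u, v)\<in>?D. (f u - f v)\<^sup>2) \<le> (\<Sum>u\<in>V. f u * \<Delta> f u)"
      using uv e_dominating V_eq by (intro dirichlet_form_ge) auto
    also have "(\<Sum>(u, v)\<in>?D. (f u - f v)\<^sup>2) = (f u - f v)\<^sup>2 + (\<Sum>v\<in>V - {e}. (f e - f v)\<^sup>2)"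
      using uv by (subst sum.insert) (auto simp: sum_star_arcs)
    also have "(\<Sum>v\<in>V - {e}. (f e - f v)\<^sup>2) = (\<Sum>v\<in>V. (f e - f v)\<^sup>2)"
      by (rule sum.mono_neutral_left) auto
    finally have "(f u - f v)\<^sup>2 + real N * (f e)\<^sup>2 \<le> 0"
      using q1 by (simp add: sum_star_squares[OF f(2)])
    moreover have "real N * (f e)\<^sup>2 \<ge> 0" "(f u - f v)\<^sup>2 \<ge> 0" by auto
    ultimately have "real N * (f e)\<^sup>2 = 0" "(f u - f v)\<^sup>2 = 0" by linarith+
    then show ?thesis using card_V n_ge_2 by auto
  qed
  obtain g where g: "g \<in> A" "g \<noteq> e" "g \<noteq> z" "\<And>v. v \<in> A \<Longrightarrow> v \<noteq> g \<Longrightarrow> (g, v) \<in> E"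
    using A_hub by blast
  have fe: "f e = 0" and fg: "f g = f z"
    using edge[of g z] g z_in_A e_neq_z by auto
  have const: "f v = f z" if "v \<in> V" "v \<noteq> e" for v
  proof (cases "v \<in> B")
    case True
    then show ?thesis using edge[OF z_adj_B[OF True]] that e_neq_z by auto
  next
    case False
    then have "v \<in> A" using that V_eq by blast
    then show ?thesis using edge[of g v] g that fg by (cases "v = g") auto
  qed
  have "(\<Sum>v\<in>V. f v) = f e + (\<Sum>v\<in>V - {e}. f v)"
    using e_in_A V_eq by (subst sum.remove[of _ e]) auto
  also have "(\<Sum>v\<in>V - {e}. f v) = (\<Sum>v\<in>V - {e}. f z)"
    using const by (intro sum.cong) auto
  also have "\<dots> = (real N - 1) * f z"
    using e_in_A V_eq card_V n_ge_2 by (simp add: card_Diff_singleton of_nat_diff)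
  finally have "f z = 0" using f(2) fe card_V n_ge_2 by simp
  then show False using f(1) const fe by metis
qed

text \<open>Both upper bounds use the same test function: comparing
  \<open>f u * \<Delta> f u\<close> with \<open>2 * (f u)\<^sup>2\<close> vertex by vertex gives the
  bound 2, and a vertex of \<open>A\<close> not adjacent to \<open>z\<close> makes it
  strict.\<close>

lemma algebraic_connectivity_le_test:
  obtains f :: "'a \<Rightarrow> real"
  where "(\<Sum>u\<in>V. (f u)\<^sup>2) > 0" and "\<And>u. u \<in> A - {e, z} \<Longrightarrow> f u \<noteq> 0"
    and "algebraic_connectivity G * (\<Sum>u\<in>V. (f u)\<^sup>2) \<le> (\<Sum>u\<in>V. f u * \<Delta> f u)"
    and "\<And>u. u \<in> V \<Longrightarrow> f u * \<Delta> f u \<le> 2 * (f u)\<^sup>2"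
    and "\<And>u. u \<in> A - {e, z} \<Longrightarrow> (z, u) \<notin> E \<Longrightarrow> f u * \<Delta> f u = (f u)\<^sup>2"
proof -
  \<comment> \<open>The values balance: \<open>B\<close> has 2 n vertices and
    \<open>A - {e, z}\<close> has 2 n - 2. Edges not meeting \<open>e\<close> or \<open>z\<close>
    join equal values, so only edges to these two count.\<close>
  define f :: "'a \<Rightarrow> real" where
    "f v = (if v = e \<or> v = z then 0 else if v \<in> B then - (real n - 1) else real n)" for v
  have f_ez: "f e = 0" "f z = 0" by (auto simp: f_def)
  have "(\<Sum>v\<in>B. f v) = (\<Sum>v\<in>B. - (real n - 1))"
    using not_in_B by (intro sum.cong) (auto simp: f_def)
  moreover have "(\<Sum>v\<in>A. f v) = (\<Sum>v\<in>A - {e, z}. real n)"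
    using AB_disjoint by (intro sum.mono_neutral_cong_right) (auto simp: f_def)
  moreover have "card (A - {e, z}) = 2 * n - 2"
    using e_in_A z_in_A e_neq_z by (simp add: card_Diff_subset card_A)
  ultimately have sum0: "(\<Sum>v\<in>V. f v) = 0"
    using n_ge_2 by (simp add: sum_V card_B of_nat_diff algebra_simps)
  have B: "f u * \<Delta> f u = 2 * (f u)\<^sup>2" if u: "u \<in> B" for u
  proof -
    obtain u' where u': "u' \<in> B" "u' \<noteq> u" "{v. (u, v) \<in> E} = {e, z, u'}"
      using B_nbrs[OF u] by blast
    have "f u' = f u" "f e = 0" "f z = 0" using u u'(1) not_in_B by (auto simp: f_def)
    moreover have "e \<noteq> u'" "z \<noteq> u'" using u'(1) not_in_B by auto
    ultimately have "\<Delta> f u = 2 * f u"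
      using e_neq_z by (simp add: graph_laplacian_def u'(3))
    then show ?thesis by (simp add: power2_eq_square)
  qed
  have A: "f u * \<Delta> f u = (if (z, u) \<in> E then 2 else 1) * (f u)\<^sup>2" if u: "u \<in> A - {e, z}" for u
  proof -
    have "\<Delta> f u = (\<Sum>v\<in>{v\<in>{e, z}. (u, v) \<in> E}. f u - f v)"
      unfolding graph_laplacian_def
      using A_nbrs_in_A[of u] u AB_disjoint
      by (intro sum.mono_neutral_right) (auto simp: f_def)
    also have "{v\<in>{e, z}. (u, v) \<in> E} = (if (z, u) \<in> E then {e, z} else {e})"
      using u e_dominating[of u] by (auto intro: E_sym)
    finally have "\<Delta> f u = (if (z, u) \<in> E then 2 else 1) * f u"
      using e_neq_z f_ez by simp
    then show ?thesis by (simp add: power2_eq_square)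
  qed
  have le: "f u * \<Delta> f u \<le> 2 * (f u)\<^sup>2" if "u \<in> V" for u
  proof (cases "u = e \<or> u = z")
    case True
    then show ?thesis by (auto simp: f_def)
  next
    case False
    then show ?thesis using that A[of u] B[of u] V_eq by (cases "u \<in> B") auto
  qed
  obtain u where "u \<in> B" using card_B n_ge_2 by fastforce
  then have "\<exists>u\<in>V. f u \<noteq> 0"
    using V_eq not_in_B n_ge_2 by (intro bexI[of _ u]) (auto simp: f_def)
  then have pos: "(\<Sum>u\<in>V. (f u)\<^sup>2) > 0" by (rule sum_squares_pos)
  show ?thesis
  proof (rule that[of f])
    show "algebraic_connectivity G * (\<Sum>u\<in>V. (f u)\<^sup>2) \<le> (\<Sum>u\<in>V. f u * \<Delta> f u)"
      using algebraic_connectivity_gt_1 card_V n_ge_2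
      by (intro algebraic_connectivity_le_rayleigh sum0) auto
    show "f u \<noteq> 0" if "u \<in> A - {e, z}" for u
      using that AB_disjoint n_ge_2 by (auto simp: f_def)
  qed (use pos le A in auto)
qed

lemma algebraic_connectivity_le_2: "algebraic_connectivity G \<le> 2"
proof -
  obtain f :: "'a \<Rightarrow> real" where f: "(\<Sum>u\<in>V. (f u)\<^sup>2) > 0"
    "algebraic_connectivity G * (\<Sum>u\<in>V. (f u)\<^sup>2) \<le> (\<Sum>u\<in>V. f u * \<Delta> f u)"
    "\<And>u. u \<in> V \<Longrightarrow> f u * \<Delta> f u \<le> 2 * (f u)\<^sup>2"
    by (rule algebraic_connectivity_le_test) blast
  have "(\<Sum>u\<in>V. f u * \<Delta> f u) \<le> 2 * (\<Sum>u\<in>V. (f u)\<^sup>2)"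
    unfolding sum_distrib_left using f(3) by (rule sum_mono)
  then have "algebraic_connectivity G * (\<Sum>u\<in>V. (f u)\<^sup>2) \<le> 2 * (\<Sum>u\<in>V. (f u)\<^sup>2)"
    using f(2) by linarith
  then show ?thesis using f(1) by (simp add: mult_le_cancel_right)
qed

lemma algebraic_connectivity_less_2:
  assumes w: "w \<in> A - {e, z}" "(z, w) \<notin> E"
  shows "algebraic_connectivity G < 2"
proof -
  obtain f :: "'a \<Rightarrow> real" where f: "(\<Sum>u\<in>V. (f u)\<^sup>2) > 0" "f w \<noteq> 0"
    "algebraic_connectivity G * (\<Sum>u\<in>V. (f u)\<^sup>2) \<le> (\<Sum>u\<in>V. f u * \<Delta> f u)"
    "\<And>u. u \<in> V \<Longrightarrow> f u * \<Delta> f u \<le> 2 * (f u)\<^sup>2" "f w * \<Delta> f w = (f w)\<^sup>2"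
    by (rule algebraic_connectivity_le_test) (use w in blast)
  have "(\<Sum>u\<in>V. f u * \<Delta> f u) < (\<Sum>u\<in>V. 2 * (f u)\<^sup>2)"
  proof (rule sum_strict_mono_ex1)
    show "\<exists>u\<in>V. f u * \<Delta> f u < 2 * (f u)\<^sup>2"
      using w f(2,5) V_eq by (intro bexI[of _ w]) auto
  qed (use f(4) in auto)
  then have "algebraic_connectivity G * (\<Sum>u\<in>V. (f u)\<^sup>2) < 2 * (\<Sum>u\<in>V. (f u)\<^sup>2)"
    using f(3) by (simp add: sum_distrib_left)
  then show ?thesis using f(1) by (simp add: mult_less_cancel_right)
qed

section \<open>The case in which \<open>A\<close> is a clique\<close>

context
  assumes A_complete: "\<And>u v. u \<in> A \<Longrightarrow> v \<in> A \<Longrightarrow> u \<noteq> v \<Longrightarrow> (u, v) \<in> E"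
begin

lemma z_dominating: "v \<in> V \<Longrightarrow> v \<noteq> z \<Longrightarrow> (z, v) \<in> E"
  using V_eq z_adj_B A_complete[of z v] z_in_A by blast

text \<open>Now \<open>e\<close> and \<open>z\<close> both dominate, and each star contributes the
  squared norm of \<open>f\<close> once.\<close>

lemma algebraic_connectivity_complete: "algebraic_connectivity G = 2"
proof (rule antisym[OF algebraic_connectivity_le_2])
  obtain f where f: "\<exists>u\<in>V. f u \<noteq> 0" "(\<Sum>u\<in>V. f u) = 0"
    and q: "(\<Sum>u\<in>V. f u * \<Delta> f u) \<le> algebraic_connectivity G * (\<Sum>u\<in>V. (f u)\<^sup>2)"
    using algebraic_connectivity_ge_rayleigh card_V n_ge_2 by auto
  let ?D1 = "{e} \<times> (V - {e})" and ?D2 = "{z} \<times> (V - {e, z})"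
  have "(\<Sum>(u, v)\<in>?D1 \<union> ?D2. (f u - f v)\<^sup>2) \<le> (\<Sum>u\<in>V. f u * \<Delta> f u)"
    using e_dominating z_dominating V_eq by (intro dirichlet_form_ge) auto
  also have "(\<Sum>(u, v)\<in>?D1 \<union> ?D2. (f u - f v)\<^sup>2) =
      (\<Sum>v\<in>V - {e}. (f e - f v)\<^sup>2) + (\<Sum>v\<in>V - {e, z}. (f z - f v)\<^sup>2)"
    using e_neq_z by (subst sum.union_disjoint) (auto simp: sum_star_arcs)
  also have "(\<Sum>v\<in>V - {e}. (f e - f v)\<^sup>2) = (\<Sum>v\<in>V. (f e - f v)\<^sup>2)"
    by (rule sum.mono_neutral_left) auto
  also have "(\<Sum>v\<in>V - {e, z}. (f z - f v)\<^sup>2) = (\<Sum>v\<in>V - {e}. (f z - f v)\<^sup>2)"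
    by (rule sum.mono_neutral_left) auto
  also have "\<dots> = (\<Sum>v\<in>V. (f z - f v)\<^sup>2) - (f z - f e)\<^sup>2"
    using e_in_A V_eq by (subst (2) sum.remove[of _ e]) auto
  finally have "2 * (\<Sum>v\<in>V. (f v)\<^sup>2) + real N * (f e)\<^sup>2 + real N * (f z)\<^sup>2 - (f z - f e)\<^sup>2
      \<le> algebraic_connectivity G * (\<Sum>u\<in>V. (f u)\<^sup>2)"
    using q by (simp add: sum_star_squares[OF f(2)])
  \<comment> \<open>The edge joining \<open>e\<close> and \<open>z\<close> lies in both stars but is
    counted once. The surplus terms at the two centres compensate for it.\<close>
  moreover have "(f z - f e)\<^sup>2 \<le> real N * (f e)\<^sup>2 + real N * (f z)\<^sup>2"
  proof -
    have "(f z - f e)\<^sup>2 \<le> 2 * (f e)\<^sup>2 + 2 * (f z)\<^sup>2"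
      using zero_le_power2[of "f z + f e"] by (simp add: power2_eq_square algebra_simps)
    also have "\<dots> \<le> real N * (f e)\<^sup>2 + real N * (f z)\<^sup>2"
      using card_V n_ge_2 by (intro add_mono mult_right_mono) auto
    finally show ?thesis .
  qed
  ultimately have "2 * (\<Sum>v\<in>V. (f v)\<^sup>2) \<le> algebraic_connectivity G * (\<Sum>u\<in>V. (f u)\<^sup>2)"
    by linarith
  then show "2 \<le> algebraic_connectivity G"
    using sum_squares_pos[OF f(1)] by (simp add: mult_le_cancel_right)
qed

text \<open>For an eigenvalue other than 0 and \<open>N\<close> an eigenfunction has sum zero and
  vanishes at the dominating vertices \<open>e\<close> and \<open>z\<close>. Without these the graph
  is a perfect matching on \<open>B\<close>, which allows only 2 and 4, next to a clique, which
  allows only 2 n if \<open>f\<close> vanishes on \<open>B\<close>.\<close>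

lemma laplacian_integral_complete: "laplacian_integral G"
  unfolding laplacian_integral_def
proof (intro allI impI)
  fix c assume "eigenvalue (laplacian G) c"
  then obtain f where f0: "\<exists>u\<in>V. f u \<noteq> 0" and f: "\<And>u. u \<in> V \<Longrightarrow> \<Delta> f u = c * f u"
    by (auto simp: eigenvalue_laplacian_iff)
  show "c \<in> \<int>"
  proof (cases "c = 0 \<or> c = real N")
    case True
    then show ?thesis by auto
  next
    case False
    have "c * (\<Sum>u\<in>V. f u) = (\<Sum>u\<in>V. \<Delta> f u)" using f by (simp add: sum_distrib_left)
    then have sum0: "(\<Sum>u\<in>V. f u) = 0" using False by (simp add: sum_graph_laplacian)
    have dom: "f x = 0" if "x \<in> V" "\<And>v. v \<in> V \<Longrightarrow> v \<noteq> x \<Longrightarrow> (x, v) \<in> E" for x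
    proof -
      have "{v. (x, v) \<in> E} = V - {x}" using that by (auto dest: E_in_V)
      from graph_laplacian_nbrs[OF this finite_V, of f] have "c * f x = real N * f x"
        using f[OF that(1)] sum0 by (simp add: sum_subtractf)
      then show ?thesis using False by simp
    qed
    have fe: "f e = 0" and fz: "f z = 0"
      using dom[of e] dom[of z] e_dominating z_dominating e_in_A z_in_A V_eq by blast+
    show ?thesis
    proof (cases "\<exists>u\<in>B. f u \<noteq> 0")
      case True
      then obtain u where u: "u \<in> B" "f u \<noteq> 0" by blast
      obtain u' where u': "u' \<in> B" "u' \<noteq> u" "{v. (u, v) \<in> E} = {e, z, u'}"
        using B_nbrs[OF u(1)] by blast
      obtain u'' where u'': "{v. (u', v) \<in> E} = {e, z, u''}" using B_nbrs[OF u'(1)] by blast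
      \<comment> \<open>By symmetry the partner of \<open>u'\<close> is \<open>u\<close>, so the
        eigenvalue equations at these two vertices form a closed system.\<close>
      have "u \<in> {v. (u', v) \<in> E}" using u'(3) by (auto intro: E_sym)
      then have nb': "{v. (u', v) \<in> E} = {e, z, u}" unfolding u'' using u(1) not_in_B by auto
      have neq: "e \<noteq> u'" "z \<noteq> u'" "e \<noteq> u" "z \<noteq> u" using u(1) u'(1) not_in_B by auto
      have "3 * f u - f u' = c * f u"
        using f[of u] u(1) neq V_eq e_neq_z fe fz by (simp add: graph_laplacian_def u'(3))
      then have 1: "f u' = (3 - c) * f u" by (simp add: algebra_simps)
      have "3 * f u' - f u = c * f u'"
        using f[of u'] u'(1) neq V_eq e_neq_z fe fz by (simp add: graph_laplacian_def nb')
      then have "f u = (3 - c) * f u'" by (simp add: algebra_simps)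
      then have "1 * f u = (3 - c)\<^sup>2 * f u" unfolding 1 by (simp add: power2_eq_square)
      then have "(3 - c)\<^sup>2 = 1" using u(2) by simp
      then have "c = 2 \<or> c = 4" by (auto simp: power2_eq_1_iff)
      then show ?thesis by auto
    next
      case False
      then obtain u where u: "u \<in> A" "f u \<noteq> 0" using f0 V_eq by blast
      have "{v. (u, v) \<in> E} = A - {u}"
        using A_complete[OF u(1)] A_nbrs_in_A[of u] u fe fz by auto
      from graph_laplacian_nbrs[OF this finite_A, of f]
      have "c * f u = 2 * real n * f u - (\<Sum>v\<in>A. f v)"
        using f[of u] u V_eq by (simp add: sum_subtractf card_A)
      moreover have "(\<Sum>v\<in>A. f v) = 0" using sum0 False by (simp add: sum_V)
      ultimately have "c = real (2 * n)" using u(2) by simp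
      then show ?thesis by (simp only: Ints_of_nat)
    qed
  qed
qed

end

end

section \<open>Dicyclic groups\<close>

text \<open>The subgroups of a cyclic group of order \<open>2 ^ m\<close> form a chain: the gcds
  with the modulus are powers of two, so one divides the other.\<close>

lemma power_of_two_multiple:
  fixes i j m :: nat
  shows "\<exists>t>0. [i * t = j] (mod 2 ^ m) \<or> [j * t = i] (mod 2 ^ m)"
proof -
  have *: "\<exists>t>0. [i * t = j] (mod 2 ^ m)" if dvd: "gcd i (2 ^ m) dvd gcd j (2 ^ m)" for i j :: nat
  proof -
    obtain d where d: "j = gcd i (2 ^ m) * d" using dvd by (meson dvd_def dvd_trans gcd_dvd1)
    obtain x where "[i * x = gcd i (2 ^ m)] (mod 2 ^ m)"
      using cong_solve_nat[of i "2 ^ m"] by (cases "i = 0") (auto simp: cong_def)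
    then have "[i * x * d = gcd i (2 ^ m) * d] (mod 2 ^ m)" by (rule cong_scalar_right)
    \<comment> \<open>Adding the modulus makes the multiplier positive without changing the
      residue.\<close>
    moreover have "[i * (x * d + 2 ^ m) = i * x * d] (mod 2 ^ m)"
      by (simp add: cong_def distrib_left mult.assoc)
    ultimately have "[i * (x * d + 2 ^ m) = j] (mod 2 ^ m)" using d cong_trans by metis
    then show ?thesis by (intro exI[of _ "x * d + 2 ^ m"]) auto
  qed
  obtain s where s: "gcd i (2 ^ m) = 2 ^ s"
    using divides_primepow_nat[of 2 "gcd i (2 ^ m)" m] by auto
  obtain t where t: "gcd j (2 ^ m) = 2 ^ t"
    using divides_primepow_nat[of 2 "gcd j (2 ^ m)" m] by auto
  consider "s \<le> t" | "t \<le> s" by linarith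
  then show ?thesis using *[of i j] *[of j i] s t by cases (auto simp: le_imp_power_dvd)
qed

section \<open>Normal forms in a dicyclic group\<close>

locale dicyclic_generators = group G for G (structure) +
  fixes n :: nat and a b :: 'a
  assumes n_ge_2: "n \<ge> 2" and order_eq: "Coset.order G = 4 * n"
    and a_carrier [simp]: "a \<in> carrier G" and b_carrier [simp]: "b \<in> carrier G"
    and generate_eq: "generate G {a, b} = carrier G"
    and a_pow_2n: "a [^] (2 * n) = \<one>" and a_pow_n: "a [^] n = b [^] (2 :: nat)"
    and ab_eq: "a \<otimes> b = b \<otimes> inv a"
begin

text \<open>Integer exponents turn inverses into negation and make \<open>p\<close> a homomorphism
  from the integers, so computations with normal forms become integer arithmetic.\<close>

definition p :: "int \<Rightarrow> 'a" where "p i = a [^] i"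
definition A :: "'a set" where "A = range p"
definition B :: "'a set" where "B = range (\<lambda>i. p i \<otimes> b)"
definition z :: 'a where "z = p (int n)"

lemma p_carrier [simp]: "p i \<in> carrier G" by (simp add: p_def)
lemma p_0 [simp]: "p 0 = \<one>" by (simp add: p_def)
lemma p_1: "p 1 = a" by (simp add: p_def)
lemma p_add: "p i \<otimes> p j = p (i + j)" by (simp add: p_def int_pow_mult)
lemma p_add': "x \<in> carrier G \<Longrightarrow> p i \<otimes> (p j \<otimes> x) = p (i + j) \<otimes> x"
  by (simp add: m_assoc[symmetric] p_add)
lemma p_minus: "inv (p i) = p (- i)" by (simp add: p_def int_pow_neg)
lemma p_nat_pow: "p i [^] (k :: nat) = p (i * int k)"
  by (simp add: p_def int_pow_pow flip: int_pow_int)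
lemma p_2n: "p (2 * int n) = \<one>"
  using a_pow_2n by (simp add: p_def flip: int_pow_int)
lemma z_carrier [simp]: "z \<in> carrier G" by (simp add: z_def)
lemma b_b: "b \<otimes> b = z"
  using a_pow_n by (simp add: z_def p_def numeral_2_eq_2 int_pow_int)
lemma z_z: "z \<otimes> z = \<one>"
  using p_2n by (simp add: z_def p_add)

lemma p_mod: "p (i mod (2 * int n)) = p i"
proof -
  have "p (2 * int n * k) = \<one>" for k
    using p_2n by (simp add: p_def int_pow_pow[symmetric])
  then have "p i = p (i mod (2 * int n)) \<otimes> \<one>"
    using p_add[of "i mod (2 * int n)" "2 * int n * (i div (2 * int n))"] by simp
  then show ?thesis by simp
qed

text \<open>
  Relations are stated with \<open>p 1\<close> instead of \<open>a\<close>: inside the locale \<open>p\<close> stands for a constant applied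
  to \<open>a\<close>, so rewriting \<open>a\<close> to \<open>p 1\<close> does not terminate.
\<close>

lemma p_1_b: "p 1 \<otimes> b = b \<otimes> p (- 1)"
  using ab_eq p_minus[of 1] by (simp add: p_1)

lemma b_p: "b \<otimes> p i = p (- i) \<otimes> b"
proof (induction i rule: int_induct[of _ 0])
  case base
  show ?case by simp
next
  case (step1 i)
  \<comment> \<open>The defining relation moves \<open>p 1\<close> from the left of \<open>b\<close>
    to its right; inserting \<open>p (- 1) \<otimes> p 1\<close> gives the opposite
    direction.\<close>
  have "b \<otimes> p 1 = p (- 1) \<otimes> (p 1 \<otimes> b) \<otimes> p 1" by (simp add: p_add')
  also have "\<dots> = p (- 1) \<otimes> b" by (simp only: p_1_b) (simp add: m_assoc p_add)
  finally have b_p_1: "b \<otimes> p 1 = p (- 1) \<otimes> b" .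
  have "b \<otimes> p (i + 1) = (b \<otimes> p i) \<otimes> p 1" by (simp add: m_assoc p_add)
  also have "\<dots> = p (- i) \<otimes> (p (- 1) \<otimes> b)" by (simp add: step1 m_assoc b_p_1)
  finally show ?case by (simp add: p_add')
next
  case (step2 i)
  have "b \<otimes> p (i - 1) = (b \<otimes> p i) \<otimes> p (- 1)" by (simp add: m_assoc p_add)
  also have "\<dots> = p (- i) \<otimes> (p 1 \<otimes> b)" by (simp add: step2 m_assoc p_1_b)
  finally show ?case by (simp add: p_add' add.commute)
qed

lemma A_A: "x \<in> A \<Longrightarrow> y \<in> A \<Longrightarrow> x \<otimes> y \<in> A"
  by (auto simp: A_def p_add)
lemma A_B: "x \<in> A \<Longrightarrow> y \<in> B \<Longrightarrow> x \<otimes> y \<in> B"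
  by (auto simp: A_def B_def p_add')
lemma pb_p: "p i \<otimes> b \<otimes> p j = p (i - j) \<otimes> b"
  by (simp add: m_assoc b_p p_add')
lemma pb_pb: "(p i \<otimes> b) \<otimes> (p j \<otimes> b) = p (i - j + int n)"
proof -
  have "(p i \<otimes> b) \<otimes> (p j \<otimes> b) = p i \<otimes> b \<otimes> p j \<otimes> b" by (simp add: m_assoc)
  also have "\<dots> = p (i - j) \<otimes> (b \<otimes> b)" by (simp add: pb_p m_assoc)
  finally show ?thesis by (simp add: b_b z_def p_add)
qed
lemma B_A: "x \<in> B \<Longrightarrow> y \<in> A \<Longrightarrow> x \<otimes> y \<in> B"
  by (auto simp: A_def B_def pb_p)
lemma B_B: "x \<in> B \<Longrightarrow> y \<in> B \<Longrightarrow> x \<otimes> y \<in> A"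
  by (auto simp: A_def B_def pb_pb)

lemma p_in_A [simp]: "p i \<in> A" by (simp add: A_def)
lemma one_in_A: "\<one> \<in> A" using p_in_A[of 0] by simp
lemma z_in_A: "z \<in> A" by (simp add: z_def)
lemma b_in_B: "b \<in> B" unfolding B_def by (rule range_eqI[of _ _ 0]) simp

text \<open>The union contains the generators and their inverses and is closed under
  products.\<close>

lemma carrier_eq: "carrier G = A \<union> B"
proof
  have "x \<in> A \<union> B" if "x \<in> generate G {a, b}" for x
    using that
  proof induction
    case (incl h)
    then show ?case using p_in_A[of 1] b_in_B by (auto simp: p_1)
  next
    case (inv h)
    have "inv b = p (int n) \<otimes> b"
      using pb_pb[of "int n" 0] p_2n by (intro inv_equality) auto
    then have "inv b \<in> B" by (simp add: B_def)
    then show ?case using inv p_minus[of 1] by (auto simp: p_1)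
  next
    case (eng h1 h2)
    then show ?case using A_A A_B B_A B_B by blast
  qed (use one_in_A in simp)
  then show "carrier G \<subseteq> A \<union> B" using generate_eq by blast
qed (auto simp: A_def B_def)

lemma A_image: "A = p ` {0..<2 * int n}" and B_image: "B = (\<lambda>i. p i \<otimes> b) ` {0..<2 * int n}"
proof -
  have range: "i mod (2 * int n) \<in> {0..<2 * int n}" for i using n_ge_2 by auto
  have "p i \<in> p ` {0..<2 * int n}" "p i \<otimes> b \<in> (\<lambda>i. p i \<otimes> b) ` {0..<2 * int n}" for i
    using imageI[OF range[of i], of p] imageI[OF range[of i], of "\<lambda>i. p i \<otimes> b"]
    by (simp_all add: p_mod)
  then show "A = p ` {0..<2 * int n}" "B = (\<lambda>i. p i \<otimes> b) ` {0..<2 * int n}"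
    unfolding A_def B_def by auto
qed

lemma finite_A: "finite A" and finite_B: "finite B"
  by (simp_all add: A_image B_image)

text \<open>Each set has at most 2 n elements and together they fill a group of order 4 n, so both
  bounds are attained and nothing is shared.\<close>

lemma
  shows card_A: "card A = 2 * n" and card_B: "card B = 2 * n" and AB_disjoint: "A \<inter> B = {}"
proof -
  have "card A \<le> 2 * n" "card B \<le> 2 * n"
    unfolding A_image B_image using card_image_le[of "{0..<2 * int n}"] by (auto simp: nat_mult_distrib)
  moreover have "card A + card B = card (A \<union> B) + card (A \<inter> B)"
    using finite_A finite_B by (rule card_Un_Int)
  moreover have "card (A \<union> B) = 4 * n"
    using order_eq by (simp add: Coset.order_def carrier_eq)
  ultimately have "card A = 2 * n \<and> card B = 2 * n \<and> card (A \<inter> B) = 0" by linarith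
  then show "card A = 2 * n" "card B = 2 * n" "A \<inter> B = {}" using finite_A by auto
qed

text \<open>The 2 n residues cover the 2 n elements of \<open>A\<close>, hence \<open>p\<close> is
  injective on them: \<open>a\<close> has order exactly 2 n.\<close>

lemma p_eq_iff: "p i = p j \<longleftrightarrow> [i = j] (mod 2 * int n)"
proof -
  have inj: "inj_on p {0..<2 * int n}"
    using card_A unfolding A_image by (intro eq_card_imp_inj_on) (auto simp: nat_mult_distrib)
  have "p i = p j \<longleftrightarrow> p (i mod (2 * int n)) = p (j mod (2 * int n))" by (simp only: p_mod)
  also have "\<dots> \<longleftrightarrow> i mod (2 * int n) = j mod (2 * int n)"
    using n_ge_2 by (intro inj_on_eq_iff[OF inj]) auto
  finally show ?thesis by (simp add: cong_def)
qed

lemma z_neq_one: "z \<noteq> \<one>"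
proof
  assume "z = \<one>"
  then have "2 * int n dvd int n" using p_eq_iff[of "int n" 0] by (simp add: z_def cong_0_iff)
  from zdvd_imp_le[OF this] show False using n_ge_2 by simp
qed

lemma finite_carrier: "finite (carrier G)"
  by (simp add: carrier_eq finite_A finite_B)

section \<open>Adjacency in the power graph\<close>

lemma power_graph_arc_iff:
  "(u, v) \<in> parcs (power_graph G) \<longleftrightarrow> u \<in> carrier G \<and> v \<in> carrier G \<and> u \<noteq> v \<and>
    (\<exists>k>0. v = u [^] (k :: nat) \<or> u = v [^] k)"
  by (auto simp: power_graph_def)

lemma A_nat_pow: "x \<in> A \<Longrightarrow> x [^] (k :: nat) \<in> A"
  by (auto simp: A_def p_nat_pow)

lemma B_square: "u \<in> B \<Longrightarrow> u \<otimes> u = z"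
  by (auto simp: B_def pb_pb z_def)

lemma B_nat_pow:
  assumes "u \<in> B"
  shows "u [^] (k :: nat) \<in> {\<one>, u, z, z \<otimes> u}"
proof (induction k)
  case (Suc k)
  have u: "u \<in> carrier G" using assms carrier_eq by blast
  have "z \<otimes> u \<otimes> u = \<one>" using u by (simp add: m_assoc B_square[OF assms] z_z)
  then show ?case using Suc u B_square[OF assms] by auto
qed simp

text \<open>An element \<open>u\<close> of \<open>B\<close> has order four, square \<open>z\<close>
  and inverse \<open>z \<otimes> u\<close>. If \<open>u\<close> is a power of \<open>v\<close>, then
  \<open>v\<close> is not in \<open>A\<close>, which is closed under powers, so \<open>v\<close> is
  in \<open>B\<close> and must be \<open>u\<close> or its inverse.\<close>

lemma B_power_graph_nbrs:
  assumes u: "u \<in> B"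
  shows "z \<otimes> u \<in> B" "z \<otimes> u \<noteq> u"
    "{v. (u, v) \<in> parcs (power_graph G)} = {\<one>, z, z \<otimes> u}"
proof -
  have uc: "u \<in> carrier G" using u carrier_eq by blast
  show zuB: "z \<otimes> u \<in> B" using A_B[OF z_in_A u] .
  show zu: "z \<otimes> u \<noteq> u" using uc z_neq_one by simp
  have zzu: "z \<otimes> (z \<otimes> u) = u" using uc by (simp add: z_z flip: m_assoc)
  have u1: "u \<noteq> \<one>" "u \<noteq> z" using u one_in_A z_in_A AB_disjoint by auto
  have pow2: "u [^] (2 :: nat) = z" using B_square[OF u] uc by (simp add: numeral_2_eq_2)
  have pow3: "u [^] (3 :: nat) = z \<otimes> u"
    using B_square[OF u] uc by (simp add: numeral_3_eq_3)
  have pow4: "u [^] (4 :: nat) = \<one>"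
    using nat_pow_mult[OF uc, of 2 2] by (simp add: pow2 z_z)
  show "{v. (u, v) \<in> parcs (power_graph G)} = {\<one>, z, z \<otimes> u}"
  proof (intro equalityI subsetI)
    fix v assume "v \<in> {v. (u, v) \<in> parcs (power_graph G)}"
    then obtain k :: nat where v: "v \<in> carrier G" "u \<noteq> v" and k: "v = u [^] k \<or> u = v [^] k"
      by (auto simp: power_graph_arc_iff)
    show "v \<in> {\<one>, z, z \<otimes> u}"
    proof (cases "v = u [^] k")
      case True
      then show ?thesis using B_nat_pow[OF u, of k] v(2) by auto
    next
      case False
      then have uk: "u = v [^] k" using k by simp
      have "v \<notin> A" using A_nat_pow[of v k] u uk AB_disjoint by auto
      then have "v \<in> B" using v(1) carrier_eq by blast
      then have "u = z \<otimes> v" using B_nat_pow[of v k] uk u1 v(2) by auto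
      then have "z \<otimes> u = v" using v(1) by (simp add: z_z flip: m_assoc)
      then show ?thesis by simp
    qed
  next
    fix v assume "v \<in> {\<one>, z, z \<otimes> u}"
    \<comment> \<open>Arcs need positive exponents, so the identity is written as the fourth
      power.\<close>
    then have "v = u [^] (4 :: nat) \<or> v = u [^] (2 :: nat) \<or> v = u [^] (3 :: nat)"
      using pow2 pow3 pow4 by auto
    then have "\<exists>k>0. v = u [^] (k :: nat)" by (metis zero_less_numeral)
    then show "v \<in> {v. (u, v) \<in> parcs (power_graph G)}"
      using \<open>v \<in> {\<one>, z, z \<otimes> u}\<close> uc zu u1 by (auto simp: power_graph_arc_iff)
  qed
qed

lemma a_hub:
  assumes "v \<in> A" "v \<noteq> a"
  shows "(a, v) \<in> parcs (power_graph G)"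
proof -
  obtain i where i: "v = p i" "0 \<le> i" using assms(1) by (auto simp: A_image)
  \<comment> \<open>The summand 2 n keeps the exponent positive when \<open>v\<close> is the
    identity.\<close>
  have "v = a [^] (nat i + 2 * n)"
    using i p_2n p_add[of i "2 * int n"] by (simp add: p_def int_pow_mult flip: int_pow_int)
  then show ?thesis
    unfolding power_graph_arc_iff
  proof (intro conjI)
    show "\<exists>k>0. v = a [^] (k :: nat) \<or> a = v [^] k"
      using n_ge_2 \<open>v = a [^] (nat i + 2 * n)\<close> by (intro exI[of _ "nat i + 2 * n"]) simp
    show "v \<in> carrier G" using assms(1) carrier_eq by blast
  qed (use assms(2) in simp_all)
qed

lemma a_neq: "a \<noteq> \<one>" "a \<noteq> z"
proof -
  have "1 mod (2 * int n) = 1" "int n mod (2 * int n) = int n"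
    using n_ge_2 by (auto intro!: mod_pos_pos_trivial)
  then show "a \<noteq> \<one>" "a \<noteq> z"
    using p_eq_iff[of 1 0] p_eq_iff[of 1 "int n"] n_ge_2 unfolding p_1 p_0 z_def cong_def by auto
qed

sublocale power_graph: dicyclic_like "power_graph G" n A B \<one> z
proof -
  interpret pg: pair_graph "power_graph G"
    by (rule pair_graph_power_graph[OF finite_carrier])
  show "dicyclic_like (power_graph G) n A B \<one> z"
  proof unfold_locales
    show "(\<one>, v) \<in> parcs (power_graph G)" if "v \<in> A \<union> B" "v \<noteq> \<one>" for v
    proof -
      \<comment> \<open>The group order serves as the positive exponent that reaches the
        identity.\<close>
      have "v [^] Coset.order G = \<one>" using that carrier_eq by (intro pow_order_eq_1) auto
      moreover have "Coset.order G > 0" using order_eq n_ge_2 by simp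
      ultimately show ?thesis using that carrier_eq by (auto simp: power_graph_arc_iff)
    qed
    show "\<exists>g\<in>A - {\<one>, z}. \<forall>v\<in>A - {g}. (g, v) \<in> parcs (power_graph G)"
      using a_hub a_neq p_in_A[of 1] by (intro bexI[of _ a]) (auto simp: p_1)
    show "\<exists>u'\<in>B. u' \<noteq> u \<and> {v. (u, v) \<in> parcs (power_graph G)} = {\<one>, z, u'}" if "u \<in> B" for u
      using B_power_graph_nbrs[OF that] by blast
  qed (use n_ge_2 carrier_eq AB_disjoint card_A card_B one_in_A z_in_A z_neq_one
       in \<open>auto simp: power_graph_def\<close>)
qed

text \<open>The exponents live modulo 2 n, again a power of two, where of any two residues one is a
  multiple of the other.\<close>

lemma A_complete:
  assumes n: "n = 2 ^ k" and uv: "u \<in> A" "v \<in> A" "u \<noteq> v"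
  shows "(u, v) \<in> parcs (power_graph G)"
proof -
  have 2: "2 * int n = int (2 ^ Suc k)" using n by simp
  have ex: "\<exists>i :: nat. x = p (int i)" if x: "x \<in> A" for x
  proof -
    obtain i where "x = p i" "0 \<le> i" using x by (auto simp: A_image)
    then show ?thesis by (intro exI[of _ "nat i"]) simp
  qed
  obtain i j :: nat where ij: "u = p (int i)" "v = p (int j)"
    using ex[OF uv(1)] ex[OF uv(2)] by blast
  obtain t where t: "t > 0" "[i * t = j] (mod 2 ^ Suc k) \<or> [j * t = i] (mod 2 ^ Suc k)"
    using power_of_two_multiple by blast
  have "p (int x * int t) = p (int y)" if "[x * t = y] (mod 2 ^ Suc k)" for x y
    unfolding p_eq_iff 2 using that by (metis cong_int_iff of_nat_mult)
  then have "v = u [^] t \<or> u = v [^] t"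
    using t(2) by (auto simp: ij p_nat_pow)
  then show ?thesis using t(1) uv carrier_eq by (auto simp: power_graph_arc_iff)
qed

text \<open>Write n as \<open>2 ^ k * m\<close> with \<open>m\<close> odd and greater than 1. The
  witness \<open>p (2 ^ Suc k)\<close> has odd order \<open>m\<close> while \<open>z\<close> has
  order two, so neither is a power of the other.\<close>

lemma z_not_adjacent:
  assumes n: "\<nexists>k. n = 2 ^ k"
  shows "\<exists>w\<in>A - {\<one>, z}. (z, w) \<notin> parcs (power_graph G)"
proof -
  obtain k m where nm: "n = 2 ^ k * m" "odd m"
    by (rule multiplicity_decompose'[of n 2]) (use n_ge_2 in auto)
  have m: "m \<noteq> 1" using n nm(1) by auto
  define w where "w = p (2 ^ Suc k)"
  have notz: "w [^] (t :: nat) \<noteq> z" for t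
  proof
    assume "w [^] t = z"
    then have "[2 ^ Suc k * int t = int n] (mod 2 * int n)"
      by (simp only: w_def z_def p_nat_pow p_eq_iff)
    then have "2 * int n dvd 2 ^ Suc k * int t - int n" by (simp add: cong_iff_dvd_diff)
    \<comment> \<open>Since \<open>2 ^ Suc k\<close> divides 2 n, the congruence makes it divide n,
      against \<open>m\<close> being odd.\<close>
    then have "(2 :: int) ^ Suc k dvd 2 ^ Suc k * int t - int n"
      by (rule dvd_trans[rotated]) (simp add: nm(1))
    then have "(2 :: int) ^ Suc k dvd int n" by (simp add: dvd_diff_right_iff)
    then have "(2 :: int) dvd int m" by (simp add: nm(1) mult.commute)
    then show False using nm(2) by simp
  qed
  have wz: "w \<noteq> z" using notz[of 1] by (auto simp: w_def)
  have w1: "w \<noteq> \<one>"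
  proof
    assume "w = \<one>"
    then have "2 * int n dvd 2 ^ Suc k" using p_eq_iff[of "2 ^ Suc k" 0] by (simp add: w_def cong_0_iff)
    then have "int m dvd 1" by (simp add: nm(1))
    then show False using m by simp
  qed
  have "(z, w) \<notin> parcs (power_graph G)"
  proof
    assume "(z, w) \<in> parcs (power_graph G)"
    then obtain t :: nat where "w = z [^] t \<or> z = w [^] t" unfolding power_graph_arc_iff by blast
    then have "w = z [^] t" using notz[of t] by auto
    moreover have "z [^] t \<in> {\<one>, z}" for t :: nat by (induction t) (auto simp: z_z)
    ultimately show False using wz w1 by auto
  qed
  then show ?thesis using wz w1 by (intro bexI[of _ w]) (auto simp: w_def)
qed

end

section \<open>The equivalences\<close>

lemma dicyclic_obtain_generators:
  assumes "dicyclic n Q"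
  obtains a b where "dicyclic_generators Q n a b"
proof -
  obtain a b where "group Q" "n \<ge> 2" "Coset.order Q = 4 * n" "a \<in> carrier Q" "b \<in> carrier Q"
    "generate Q {a, b} = carrier Q" "a [^]\<^bsub>Q\<^esub> (2 * n) = \<one>\<^bsub>Q\<^esub>"
    "a [^]\<^bsub>Q\<^esub> n = b [^]\<^bsub>Q\<^esub> (2 :: nat)" "a \<otimes>\<^bsub>Q\<^esub> b = b \<otimes>\<^bsub>Q\<^esub> inv\<^bsub>Q\<^esub> a"
    using assms unfolding dicyclic_def by auto
  then have "dicyclic_generators Q n a b"
    by (intro dicyclic_generators.intro dicyclic_generators_axioms.intro)
  then show ?thesis by (rule that)
qed

text \<open>The group order 4 n determines n, so a second dicyclic structure on the same group has
  the same parameter.\<close>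

lemma generalized_quaternion_iff:
  assumes "dicyclic n Q"
  shows "generalized_quaternion Q \<longleftrightarrow> (\<exists>k. n = 2 ^ k)"
  using assms by (auto simp: generalized_quaternion_def dicyclic_def)

theorem theorem3p11:
  fixes n :: nat and Q :: "('a, 'b) monoid_scheme"
  assumes "n \<ge> 2"
    and "dicyclic n Q"
  shows "(real (vertex_connectivity (power_graph Q)) = algebraic_connectivity (power_graph Q)
            \<longleftrightarrow> algebraic_connectivity (power_graph Q) = 2)
       \<and> (algebraic_connectivity (power_graph Q) = 2
            \<longleftrightarrow> algebraic_connectivity (power_graph Q) \<in> \<int>)
       \<and> (algebraic_connectivity (power_graph Q) \<in> \<int>
            \<longleftrightarrow> laplacian_integral (power_graph Q))
       \<and> (laplacian_integral (power_graph Q)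
            \<longleftrightarrow> generalized_quaternion Q)"
proof -
  obtain a b where "dicyclic_generators Q n a b"
    by (rule dicyclic_obtain_generators[OF assms(2)])
  then interpret dicyclic_generators Q n a b .
  let ?l = "algebraic_connectivity (power_graph Q)"
  note vc = power_graph.vertex_connectivity_eq_2 and gq = generalized_quaternion_iff[OF assms(2)]
  \<comment> \<open>The algebraic connectivity is itself an eigenvalue.\<close>
  have ev: "laplacian_integral (power_graph Q) \<Longrightarrow> ?l \<in> \<int>"
    using power_graph.eigenvalue_algebraic_connectivity power_graph.card_V n_ge_2
    by (simp add: laplacian_integral_def)
  \<comment> \<open>All five statements hold if n is a power of two. Otherwise all fail, because the
    algebraic connectivity lies strictly between 1 and 2.\<close>
  show ?thesis
  proof (cases "\<exists>k. n = 2 ^ k")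
    case True
    then obtain k where k: "n = 2 ^ k" by blast
    show ?thesis
      using power_graph.algebraic_connectivity_complete[OF A_complete[OF k]]
        power_graph.laplacian_integral_complete[OF A_complete[OF k]] True
      by (simp add: vc gq)
  next
    case False
    then obtain w where "w \<in> A - {\<one>\<^bsub>Q\<^esub>, z}" "(z, w) \<notin> parcs (power_graph Q)"
      using z_not_adjacent by blast
    then have less: "1 < ?l" "?l < 2"
      using power_graph.algebraic_connectivity_gt_1 power_graph.algebraic_connectivity_less_2 by auto
    have "?l \<notin> \<int>"
    proof
      assume "?l \<in> \<int>"
      then obtain i :: int where "?l = of_int i" by (rule Ints_cases)
      then show False using less by simp
    qed
    then show ?thesis using less ev False by (auto simp: vc gq)
  qed
qed

end
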